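(* Let $\theta\in\mathbb{R}^5$ and let $$\ldots\rightarrow v_n\rightarrow v_{n-1}\rightarrow\ldots\rightarrow v_2\rightarrow v_1\rightarrow v_0$$ be an infinite path in the directed graph $G^{**}_{\theta}$ (that is, $(v_n,v_{n-1})$ is an edge of $G^{**}_\theta$ for every $n\ge 1$; the vertices need not be distinct). Let $W_1,W_2,\ldots$ be independent random variables such that $W_n\sim\beta^{(v_n,v_{n-1})}$ for all $n\geq 1$. Put $F_j=H_{W_j}$ and $Z_n(x)=F_1\circ F_2\circ\cdots\circ F_n(x)$ for $x>0$. Then almost surely the limit $$Z=\lim_{n\rightarrow\infty}Z_n(x)=\cfrac{1}{1+\cfrac{W_1}{1+\cfrac{W_2}{1+\cdots}}}$$ exists and does not depend on $x$, and its distribution is $Z\sim BH_{v_0}$.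
   Context: $\mathbb{N}=\{0,1,2,\ldots\}$. $_2F_1(p,q;r;x)=\sum_{n\ge0}\frac{(p)_n(q)_n}{n!(r)_n}x^n$ with $(t)_0=1$, $(t)_{n+1}=(t+n)(t)_n$, for real $p,q,r$ with $r\notin-\mathbb{N}$ and $0<x<1$. $P$ is the set of $(a,b,p,q,r)\in\mathbb{R}^5$ such that $r\notin-\mathbb{N}$, $_2F_1(p,q;r;x)>0$ for all $x\in(0,1)$, $a>0$, $b>0$ and $r+b-p-q>0$. For $(a,b,p,q,r)\in P$, the beta-hypergeometric distribution $BH(a,b,p,q,r)$ is the probability on $(0,1)$ with density proportional to $x^{a-1}(1-x)^{b-1}\,_2F_1(p,q;r;x)$. $\theta$-parameterization: for $\theta=(\theta_1,\ldots,\theta_5)\in\mathbb{R}^5$ set $a=\theta_4+\theta_5$, $b=\theta_1+\theta_3$, $p=\theta_3+\theta_5$, $q=\theta_3+\theta_4$, $r=\theta_2+\theta_3+\theta_4+\theta_5$. If $(a,b,p,q,r)\in P$ we say that $BH_\theta$ exists and put $BH_\theta=BH(a,b,p,q,r)$. Existence and value of $BH_\theta$ are unchanged by exchanging $\theta_2$ with $\theta_3$, or $\theta_4$ with $\theta_5$, so for a triple $v=(\theta_1,\{\theta_2,\theta_3\},\{\theta_4,\theta_5\})$, where $\{\cdot,\cdot\}$ denotes an unordered pair with repetition allowed (multiset), one writes $BH_v=BH_\theta$. Graphs: for $\theta\in\mathbb{R}^5$, $G_\theta$ is the finite directed graph whose vertices are all triples $(t_1,\{t_2,t_3\},\{t_4,t_5\})$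 with $(t_1,\ldots,t_5)$ a rearrangement of $(\theta_1,\ldots,\theta_5)$, and whose edges issued from $v=(t_1,\{t_2,t_3\},\{t_4,t_5\})$ go to $(t_5,\{t_1,t_4\},\{t_2,t_3\})$ and to $(t_4,\{t_1,t_5\},\{t_2,t_3\})$ (these may coincide; loops are allowed). The edge from $v$ to $(t_5,\{t_1,t_4\},\{t_2,t_3\})$ is acceptable if $t_2+t_3>0$ and $t_1+t_5>0$; the edge from $v$ to $(t_4,\{t_1,t_5\},\{t_2,t_3\})$ is acceptable if $t_2+t_3>0$ and $t_1+t_4>0$. $G^*_\theta$ is obtained from $G_\theta$ by removing the non-acceptable edges. $G^{**}_\theta$ is obtained from $G^*_\theta$ by removing the vertices $v$ such that $BH_v$ does not exist, together with all edges adjacent to them. For $c,d>0$, $\beta^{(2)}_{c,d}$ is the probability on $(0,\infty)$ with density $\frac{1}{B(c,d)}\frac{w^{c-1}}{(1+w)^{c+d}}$. For an acceptable edge $(v,v')$ with $v=(t_1,\{t_2,t_3\},\{t_4,t_5\})$, $\beta^{(v,v')}$ denotes $\beta^{(2)}_{t_1+t_5,\,t_2+t_3}$ if $v'=(t_5,\{t_1,t_4\},\{t_2,t_3\})$ and $\beta^{(2)}_{t_1+t_4,\,t_2+t_3}$ if $v'=(t_4,\{t_1,t_5\},\{t_2,t_3\})$. For $w>0$, $H_w(x)=\frac{1}{1+wx}$. *)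

theory Defs
  imports "HOL-Probability.Probability" "Graph_Theory.Pair_Digraph"
begin

type_synonym real5 = "real \<times> real \<times> real \<times> real \<times> real"

subsection \<open>Beta-hypergeometric distributions\<close>

definition hypergeo_2F1 :: "real \<Rightarrow> real \<Rightarrow> real \<Rightarrow> real \<Rightarrow> real" where
  "hypergeo_2F1 p q r x =
     (\<Sum>n. pochhammer p n * pochhammer q n / (fact n * pochhammer r n) * x ^ n)"

definition BH_params :: "real5 set" where
  "BH_params = {(a, b, p, q, r). r \<notin> \<int>\<^sub>\<le>\<^sub>0 \<and> (\<forall>x\<in>{0<..<1}. hypergeo_2F1 p q r x > 0)
      \<and> a > 0 \<and> b > 0 \<and> r + b - p - q > 0}"

fun BH_kernel :: "real5 \<Rightarrow> real \<Rightarrow> real" where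
  "BH_kernel (a, b, p, q, r) x =
     x powr (a - 1) * (1 - x) powr (b - 1) * hypergeo_2F1 p q r x"

text \<open>Only meaningful for parameters in \<^const>\<open>BH_params\<close>.\<close>

definition BH :: "real5 \<Rightarrow> real measure" where
  "BH s = density lborel (\<lambda>x. ennreal
     (indicator {0<..<1} x * BH_kernel s x / (LINT y:{0<..<1}|lborel. BH_kernel s y)))"

fun params_of_theta :: "real5 \<Rightarrow> real5" where
  "params_of_theta (t1, t2, t3, t4, t5) =
     (t4 + t5, t1 + t3, t3 + t5, t3 + t4, t2 + t3 + t4 + t5)"

definition BH_theta_exists :: "real5 \<Rightarrow> bool" where
  "BH_theta_exists t \<longleftrightarrow> params_of_theta t \<in> BH_params"

definition BH_theta :: "real5 \<Rightarrow> real measure" where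
  "BH_theta t = BH (params_of_theta t)"

subsection \<open>The graphs\<close>

type_synonym vertex = "real \<times> real multiset \<times> real multiset"

fun vertex_of :: "real5 \<Rightarrow> vertex" where
  "vertex_of (t1, t2, t3, t4, t5) = (t1, {#t2, t3#}, {#t4, t5#})"

text \<open>
  Existence and value of \<^const>\<open>BH_theta\<close> are unchanged by exchanging the second with the
  third entry, or the fourth with the fifth, so they do not depend on the choice of a
  representative of the vertex.  (For the second and third entry this is Euler's transformation
  of the hypergeometric function; it is not proved here.)
\<close>

definition vertex_rep :: "vertex \<Rightarrow> real5" where
  "vertex_rep v = (SOME t. vertex_of t = v)"

definition BH_vertex_exists :: "vertex \<Rightarrow> bool" where
  "BH_vertex_exists v \<longleftrightarrow> BH_theta_exists (vertex_rep v)"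

definition BH_vertex :: "vertex \<Rightarrow> real measure" where
  "BH_vertex v = BH_theta (vertex_rep v)"

fun entries :: "real5 \<Rightarrow> real multiset" where
  "entries (t1, t2, t3, t4, t5) = {#t1, t2, t3, t4, t5#}"

text \<open>
  The two edges issued from a vertex have the same target only if \<open>t4 = t5\<close>; then they also
  carry the same acceptability condition and the same law, so that pairs of vertices suffice to
  represent edges.
\<close>

definition G :: "real5 \<Rightarrow> vertex pair_pre_digraph" where
  "G \<theta> = \<lparr> pverts = {vertex_of t | t. entries t = entries \<theta>},
     parcs = {(v, v'). \<exists>t1 t2 t3 t4 t5. entries (t1, t2, t3, t4, t5) = entries \<theta>
        \<and> v = (t1, {#t2, t3#}, {#t4, t5#})
        \<and> (v' = (t5, {#t1, t4#}, {#t2, t3#}) \<or> v' = (t4, {#t1, t5#}, {#t2, t3#}))} \<rparr>"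

definition acceptable :: "vertex \<Rightarrow> vertex \<Rightarrow> bool" where
  "acceptable v v' \<longleftrightarrow> (\<exists>t1 t2 t3 t4 t5. v = (t1, {#t2, t3#}, {#t4, t5#})
     \<and> (v' = (t5, {#t1, t4#}, {#t2, t3#}) \<and> t2 + t3 > 0 \<and> t1 + t5 > 0
      \<or> v' = (t4, {#t1, t5#}, {#t2, t3#}) \<and> t2 + t3 > 0 \<and> t1 + t4 > 0))"

definition G_star :: "real5 \<Rightarrow> vertex pair_pre_digraph" where
  "G_star \<theta> = \<lparr> pverts = pverts (G \<theta>),
     parcs = {(v, v') \<in> parcs (G \<theta>). acceptable v v'} \<rparr>"

definition G_star_star :: "real5 \<Rightarrow> vertex pair_pre_digraph" where
  "G_star_star \<theta> = \<lparr> pverts = {v \<in> pverts (G_star \<theta>). BH_vertex_exists v},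
     parcs = {(v, v') \<in> parcs (G_star \<theta>). BH_vertex_exists v \<and> BH_vertex_exists v'} \<rparr>"

subsection \<open>Beta distributions of the second kind and the random maps\<close>

definition beta2 :: "real \<Rightarrow> real \<Rightarrow> real measure" where
  "beta2 c d = density lborel (\<lambda>w. ennreal
     (indicator {0<..} w * (1 / Beta c d * (w powr (c - 1) / (1 + w) powr (c + d)))))"

text \<open>
  For an edge from \<open>v = (t1, {#t2, t3#}, {#t4, t5#})\<close> to \<open>v'\<close>, the first component of \<open>v'\<close>
  is \<open>t5\<close> or \<open>t4\<close>, depending on which of the two edges it is; hence the first parameter
  below is \<open>t1 + t5\<close> or \<open>t1 + t4\<close>, respectively, and the second one is \<open>t2 + t3\<close>.
\<close>

definition beta_edge :: "vertex \<Rightarrow> vertex \<Rightarrow> real measure" where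
  "beta_edge v v' = beta2 (fst v + fst v') (sum_mset (fst (snd v)))"

definition H :: "real \<Rightarrow> real \<Rightarrow> real" where
  "H w x = 1 / (1 + w * x)"

primrec comp_H :: "(nat \<Rightarrow> real) \<Rightarrow> nat \<Rightarrow> real \<Rightarrow> real" where
  "comp_H w 0 = id"
| "comp_H w (Suc n) = comp_H w n \<circ> H (w (Suc n))"

text \<open>The \<open>n\<close>-th convergent \<open>1 / (1 + w 1 / (1 + w 2 / (\<dots> / (1 + w n))))\<close>.\<close>

definition cfrac_convergent :: "(nat \<Rightarrow> real) \<Rightarrow> nat \<Rightarrow> real" where
  "cfrac_convergent w n = 1 / (1 + foldr (\<lambda>j y. w j / (1 + y)) [1..<Suc n] 0)"

end

theory Submission
  imports Defs "HOL-Real_Asymp.Real_Asymp"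
begin

text \<open>
  If \<open>(v, v')\<close> is an acceptable edge, \<open>X\<close> has law \<open>BH\<^sub>v\<close> and \<open>W\<close> is independent of \<open>X\<close> with law
  \<open>\<beta>\<close> of the edge, then \<open>1 / (1 + W X)\<close> has law \<open>BH\<^sub>v'\<close>.  Indeed, given \<open>X = x\<close> the density of
  \<open>1 / (1 + W x)\<close> at \<open>y\<close> involves \<open>y\<close> and \<open>x\<close> jointly only through a power of \<open>1 - (1 - x) y\<close>.
  Expanding this power, the coefficients of the density of \<open>1 / (1 + W X)\<close> are the moments
  \<open>\<integral> x\<^sup>r\<^sup>-\<^sup>1 (1 - x)\<^sup>b\<^sup>+\<^sup>n\<^sup>-\<^sup>1 F(x) dx\<close>, whose successive quotients are rational in \<open>n\<close> by a contiguity
  relation at \<open>1\<close>; so the density is again hypergeometric.  Independence of the representative of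
  a vertex is Euler's transformation.

  Applying \<open>H\<^sub>w\<close> contracts \<open>max x y / min x y - 1\<close> on \<open>(0, 1]\<close> by the factor \<open>w / (1 + w)\<close>.  As the
  \<open>W\<^sub>n\<close> have only finitely many laws, almost surely \<open>W\<^sub>n\<close> stays below a constant infinitely often, so
  the nested intervals \<open>Z\<^sub>n [0, 1]\<close> shrink to a point \<open>Z\<close>.  Feeding an independent \<open>X\<^sub>n\<close> with law
  \<open>BH\<close> of \<open>v\<^sub>n\<close> into \<open>Z\<^sub>n\<close> gives the law \<open>BH\<close> of \<open>v\<^sub>0\<close> for every \<open>n\<close>, hence in the limit for \<open>Z\<close>.
\<close>

section \<open>Hypergeometric series\<close>

text \<open>Compared with this quotient, \<open>rGamma_series\<close> has the extra factor
  \<open>z + n\<close> above and one more power of \<open>n\<close> below; multiplying by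
  \<open>n / (z + n)\<close>, which tends to 1, removes both.\<close>

lemma pochhammer_asymp:
  fixes z :: real
  shows "(\<lambda>n. pochhammer z n / (fact n * real n powr (z - 1))) \<longlonglongrightarrow> rGamma z"
proof -
  have "(\<lambda>n. rGamma_series z n * (real n / (z + real n))) \<longlonglongrightarrow> rGamma z * 1"
    by (intro tendsto_mult rGamma_series_LIMSEQ) real_asymp
  moreover have "\<forall>\<^sub>F n in sequentially.
      rGamma_series z n * (real n / (z + real n)) = pochhammer z n / (fact n * real n powr (z - 1))"
    using eventually_gt_at_top[of "nat \<lceil>\<bar>z\<bar>\<rceil>"]
  proof eventually_elim
    case (elim n)
    then have "z + real n \<noteq> 0" "real n > 0" by linarith+
    then show ?case
      by (simp add: rGamma_series_def pochhammer_Suc powr_def exp_diff divide_simps left_diff_distrib)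
  qed
  ultimately show ?thesis
    unfolding mult_1_right by (rule Lim_transform_eventually)
qed

section \<open>Growth of the coefficients and absolute convergence\<close>

definition hypergeo_coeff :: "real \<Rightarrow> real \<Rightarrow> real \<Rightarrow> nat \<Rightarrow> real" where
  "hypergeo_coeff p q r n = pochhammer p n * pochhammer q n / (fact n * pochhammer r n)"

lemma hypergeo_2F1_eq: "hypergeo_2F1 p q r x = (\<Sum>n. hypergeo_coeff p q r n * x ^ n)"
  by (simp add: hypergeo_2F1_def hypergeo_coeff_def)

lemma hypergeo_coeff_commute: "hypergeo_coeff p q r = hypergeo_coeff q p r"
  by (simp add: hypergeo_coeff_def fun_eq_iff mult.commute)

lemma hypergeo_coeff_0 [simp]: "hypergeo_coeff p q r 0 = 1"
  by (simp add: hypergeo_coeff_def)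

lemma pochhammer_nonzero:
  fixes r :: real
  assumes "r \<notin> \<int>\<^sub>\<le>\<^sub>0"
  shows "pochhammer r n \<noteq> 0"
  using assms by (auto simp: pochhammer_eq_0_iff)

lemma add_of_nat_nonzero:
  fixes r :: real
  assumes "r \<notin> \<int>\<^sub>\<le>\<^sub>0"
  shows "r + real n \<noteq> 0"
  using assms by (metis add_eq_0_iff2 minus_of_nat_in_nonpos_Ints)

lemma hypergeo_coeff_Suc:
  assumes "r \<notin> \<int>\<^sub>\<le>\<^sub>0"
  shows "hypergeo_coeff p q r (Suc n)
    = hypergeo_coeff p q r n * ((p + n) * (q + n) / ((n + 1) * (r + n)))"
  using pochhammer_nonzero[OF assms, of n] add_of_nat_nonzero[OF assms, of n]
  by (simp add: hypergeo_coeff_def pochhammer_Suc divide_simps)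

text \<open>Each Pochhammer symbol over \<open>fact n\<close> behaves like a power of
  \<open>n\<close>, and the three factorials combine to the single one in the coefficient. Writing
  the limit with \<open>rGamma\<close> covers terminating series, for which it is 0.\<close>

lemma hypergeo_coeff_asymp:
  assumes "r \<notin> \<int>\<^sub>\<le>\<^sub>0"
  shows "(\<lambda>n. hypergeo_coeff p q r n / real n powr (p + q - r - 1))
    \<longlonglongrightarrow> rGamma p * rGamma q / rGamma r"
proof -
  have "(\<lambda>n. pochhammer p n / (fact n * real n powr (p - 1)) * (pochhammer q n / (fact n * real n powr (q - 1)))
      / (pochhammer r n / (fact n * real n powr (r - 1)))) \<longlonglongrightarrow> rGamma p * rGamma q / rGamma r"
    using assms by (intro tendsto_intros pochhammer_asymp) (simp add: rGamma_eq_zero_iff)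
  moreover have "\<forall>\<^sub>F n in sequentially. pochhammer p n / (fact n * real n powr (p - 1))
      * (pochhammer q n / (fact n * real n powr (q - 1))) / (pochhammer r n / (fact n * real n powr (r - 1)))
    = hypergeo_coeff p q r n / real n powr (p + q - r - 1)"
    using eventually_gt_at_top[of 0]
  proof eventually_elim
    case (elim n)
    moreover have "p + q - r - 1 = (p - 1) + (q - 1) - (r - 1)" by simp
    ultimately show ?case
      by (simp only: powr_diff powr_add) (simp add: hypergeo_coeff_def divide_simps)
  qed
  ultimately show ?thesis
    by (rule Lim_transform_eventually)
qed

text \<open>A convergent quotient is bounded, so \<open>f\<close> is eventually dominated by a
  multiple of \<open>n powr e\<close>; the limit \<open>L\<close> may be 0.\<close>

lemma summable_powr_asymp:
  fixes f :: "nat \<Rightarrow> real"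
  assumes lim: "(\<lambda>n. f n / real n powr e) \<longlonglongrightarrow> L" and e: "e < -1"
  shows "summable (\<lambda>n. \<bar>f n\<bar>)"
proof -
  from lim have "Bseq (\<lambda>n. f n / real n powr e)"
    by (rule convergentI[THEN convergent_imp_Bseq])
  then obtain K where K: "\<And>n. norm (f n / real n powr e) \<le> K"
    by (auto simp: Bseq_def)
  show ?thesis
  proof (rule summable_comparison_test_ev)
    show "summable (\<lambda>n. K * real n powr e)"
      using e by (intro summable_mult) (simp add: summable_real_powr_iff)
    show "\<forall>\<^sub>F n in sequentially. norm \<bar>f n\<bar> \<le> K * real n powr e"
      using eventually_gt_at_top[of 0]
    proof eventually_elim
      case (elim n)
      then show ?case using K[of n] by (simp add: divide_simps)
    qed
  qed
qed

lemma hypergeo_coeff_summable_abs: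
  assumes "r \<notin> \<int>\<^sub>\<le>\<^sub>0" "p + q < r"
  shows "summable (\<lambda>n. \<bar>hypergeo_coeff p q r n\<bar>)"
  by (rule summable_powr_asymp[OF hypergeo_coeff_asymp]) (use assms in auto)

lemma hypergeo_summable_abs:
  assumes r: "r \<notin> \<int>\<^sub>\<le>\<^sub>0" and x: "\<bar>x\<bar> < 1"
  shows "summable (\<lambda>n. \<bar>hypergeo_coeff p q r n * x ^ n\<bar>)"
proof -
  \<comment> \<open>Ratio test: the quotients of successive terms tend to \<bar>x\<bar> in absolute
    value, so any \<open>c\<close> strictly in between eventually bounds them.\<close>
  obtain c where c: "\<bar>x\<bar> < c" "c < 1"
    using x dense by blast
  have "(\<lambda>n. \<bar>(p + real n) * (q + real n) / ((real n + 1) * (r + real n)) * x\<bar>) \<longlonglongrightarrow> \<bar>1 * x\<bar>"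
    by (intro tendsto_rabs tendsto_mult tendsto_const) real_asymp
  then have "\<forall>\<^sub>F n in sequentially. \<bar>(p + real n) * (q + real n) / ((real n + 1) * (r + real n)) * x\<bar> < c"
    using c(1) unfolding mult_1 by (rule order_tendstoD(2))
  then obtain N where N: "\<And>n. n \<ge> N \<Longrightarrow> \<bar>(p + real n) * (q + real n) / ((real n + 1) * (r + real n)) * x\<bar> < c"
    by (auto simp: eventually_sequentially)
  show ?thesis
  proof (rule summable_ratio_test[OF c(2)])
    fix n assume "N \<le> n"
    then have "\<bar>hypergeo_coeff p q r n * x ^ n\<bar> * \<bar>(p + real n) * (q + real n) / ((real n + 1) * (r + real n)) * x\<bar>
        \<le> \<bar>hypergeo_coeff p q r n * x ^ n\<bar> * c"
      using N[of n] by (intro mult_left_mono) auto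
    then show "norm \<bar>hypergeo_coeff p q r (Suc n) * x ^ Suc n\<bar>
        \<le> c * norm \<bar>hypergeo_coeff p q r n * x ^ n\<bar>"
      by (simp add: hypergeo_coeff_Suc[OF r] abs_mult mult_ac)
  qed
qed

lemma hypergeo_sums:
  assumes "r \<notin> \<int>\<^sub>\<le>\<^sub>0" "\<bar>x\<bar> < 1"
  shows "(\<lambda>n. hypergeo_coeff p q r n * x ^ n) sums hypergeo_2F1 p q r x"
  unfolding hypergeo_2F1_eq
  by (intro summable_sums summable_rabs_cancel[OF hypergeo_summable_abs[OF assms]])

lemma hypergeo_2F1_commute: "hypergeo_2F1 p q r = hypergeo_2F1 q p r"
  by (simp add: hypergeo_2F1_eq hypergeo_coeff_commute fun_eq_iff)

text \<open>Telescope \<open>n u\<^sub>n\<close>, where \<open>u\<^sub>n\<close> are the terms of the series at \<open>1\<close>; iterating the relation gives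
  Gauss's evaluation of the series at \<open>1\<close>.\<close>

lemma hypergeo_at_1_contiguous:
  assumes c: "c \<notin> \<int>\<^sub>\<le>\<^sub>0" "c + 1 \<notin> \<int>\<^sub>\<le>\<^sub>0" and pq: "p + q < c"
  shows "(c - p) * (c - q) * (\<Sum>n. hypergeo_coeff p q (c + 1) n)
    = c * (c - p - q) * (\<Sum>n. hypergeo_coeff p q c n)"
proof -
  let ?u = "hypergeo_coeff p q c" and ?v = "hypergeo_coeff p q (c + 1)"
  have c0: "c \<noteq> 0" using add_of_nat_nonzero[OF c(1), of 0] by simp
  have v: "?v n = ?u n * c / (c + n)" for n
  proof -
    have "c * pochhammer (c + 1) n = pochhammer c n * (c + n)"
      by (metis pochhammer_Suc pochhammer_rec)
    then show ?thesis
      using c0 pochhammer_nonzero[OF c(1), of n] pochhammer_nonzero[OF c(2), of n]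
        add_of_nat_nonzero[OF c(1), of n]
      by (simp add: hypergeo_coeff_def divide_simps mult_ac)
  qed
  have tele: "c * (c - p - q) * ?u n - (c - p) * (c - q) * ?v n
      = - c * (real (Suc n) * ?u (Suc n) - real n * ?u n)" for n
    using add_of_nat_nonzero[OF c(1), of n]
    by (simp add: v hypergeo_coeff_Suc[OF c(1)] divide_simps) algebra
  \<comment> \<open>The boundary term of the telescoping sum vanishes at infinity:
    \<open>n * ?u n\<close> is of order \<open>n powr (p + q - c)\<close>, and
    \<open>p + q < c\<close>.\<close>
  have "(\<lambda>n. ?u n / real n powr (p + q - c - 1) * real n powr (p + q - c)) \<longlonglongrightarrow>
      rGamma p * rGamma q / rGamma c * 0"
    using pq by (intro tendsto_mult hypergeo_coeff_asymp c) real_asymp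
  moreover have "\<forall>\<^sub>F n in sequentially.
      ?u n / real n powr (p + q - c - 1) * real n powr (p + q - c) = real n * ?u n"
    using eventually_gt_at_top[of 0]
    by eventually_elim (simp add: powr_diff)
  ultimately have "(\<lambda>n. real n * ?u n) \<longlonglongrightarrow> 0"
    unfolding mult_zero_right by (rule Lim_transform_eventually)
  then have "(\<lambda>n. real (Suc n) * ?u (Suc n) - real n * ?u n) sums (0 - real 0 * ?u 0)"
    by (rule telescope_sums)
  from sums_mult[OF this, of "- c"]
  have "(\<lambda>n. c * (c - p - q) * ?u n - (c - p) * (c - q) * ?v n) sums 0"
    by (simp only: tele) simp
  moreover have "(\<lambda>n. c * (c - p - q) * ?u n - (c - p) * (c - q) * ?v n) sums
      (c * (c - p - q) * suminf ?u - (c - p) * (c - q) * suminf ?v)"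
    using pq by (intro sums_diff sums_mult summable_sums
        summable_rabs_cancel[OF hypergeo_coeff_summable_abs] c) auto
  ultimately have "0 = c * (c - p - q) * suminf ?u - (c - p) * (c - q) * suminf ?v"
    by (rule sums_unique2)
  then show ?thesis by simp
qed

section \<open>Euler's transformation\<close>

definition hypergeo_fps :: "real \<Rightarrow> real \<Rightarrow> real \<Rightarrow> real fps" where
  "hypergeo_fps p q r = Abs_fps (hypergeo_coeff p q r)"

text \<open>The hypergeometric differential operator
  \<open>X (1 - X) f'' + (r - (p + q + 1) X) f' - p q f\<close>, multiplied out. On formal series,
  uniqueness of solutions becomes a statement about coefficients.\<close>

definition hypergeo_ode :: "real \<Rightarrow> real \<Rightarrow> real \<Rightarrow> real fps \<Rightarrow> real fps" where
  "hypergeo_ode p q r f = fps_X * (fps_deriv (fps_deriv f)) - fps_X * (fps_X * fps_deriv (fps_deriv f))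
    + fps_const r * fps_deriv f - (fps_const p + fps_const q + 1) * (fps_X * fps_deriv f)
    - fps_const p * fps_const q * f"

lemma hypergeo_ode_nth:
  "fps_nth (hypergeo_ode p q r f) n
    = real (Suc n) * (r + real n) * fps_nth f (Suc n) - (p + real n) * (q + real n) * fps_nth f n"
proof (cases n)
  case 0
  then show ?thesis
    by (simp add: hypergeo_ode_def distrib_right mult.assoc)
next
  case (Suc m)
  then show ?thesis
    by (cases m) (simp_all add: hypergeo_ode_def mult.assoc algebra_simps)
qed

text \<open>Since \<open>r + n\<close> never vanishes, \<open>hypergeo_ode_nth\<close> turns the
  equation into a recursion that determines every coefficient from the constant one.\<close>

lemma hypergeo_ode_eq_0_iff:
  assumes r: "r \<notin> \<int>\<^sub>\<le>\<^sub>0" and c: "fps_nth f 0 = c"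
  shows "hypergeo_ode p q r f = 0 \<longleftrightarrow> f = fps_const c * hypergeo_fps p q r"
proof
  assume ode: "hypergeo_ode p q r f = 0"
  have "fps_nth f n = c * hypergeo_coeff p q r n" for n
  proof (induction n)
    case (Suc n)
    have "real (Suc n) * (r + real n) * fps_nth f (Suc n) = (p + real n) * (q + real n) * fps_nth f n"
      using hypergeo_ode_nth[of p q r f n] ode by simp
    then have "fps_nth f (Suc n) = (p + real n) * (q + real n) * fps_nth f n / (real (Suc n) * (r + real n))"
      using add_of_nat_nonzero[OF r, of n] by (simp add: eq_divide_eq mult_ac del: of_nat_Suc)
    with Suc show ?case
      by (simp add: hypergeo_coeff_Suc[OF r] add.commute mult_ac)
  qed (simp add: c)
  then show "f = fps_const c * hypergeo_fps p q r"
    by (simp add: fps_eq_iff hypergeo_fps_def)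
next
  assume "f = fps_const c * hypergeo_fps p q r"
  then have "fps_nth f n = c * hypergeo_coeff p q r n" for n
    by (simp add: hypergeo_fps_def)
  then have "fps_nth (hypergeo_ode p q r f) n = 0" for n
    using add_of_nat_nonzero[OF r, of n]
    by (simp add: hypergeo_ode_nth hypergeo_coeff_Suc[OF r] divide_simps)
  then show "hypergeo_ode p q r f = 0"
    by (simp add: fps_eq_iff)
qed

text \<open>The formal binomial series of \<open>1 - X\<close> to the power
  \<open>- s\<close>.\<close>

definition one_minus_X_powr :: "real \<Rightarrow> real fps" where
  "one_minus_X_powr s = Abs_fps (\<lambda>n. pochhammer s n / fact n)"

lemma one_minus_X_powr_deriv:
  "(1 - fps_X) * fps_deriv (one_minus_X_powr s) = fps_const s * one_minus_X_powr s"
proof (rule fps_ext)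
  fix n
  show "fps_nth ((1 - fps_X) * fps_deriv (one_minus_X_powr s)) n = fps_nth (fps_const s * one_minus_X_powr s) n"
    by (cases n) (simp_all add: left_diff_distrib one_minus_X_powr_def pochhammer_Suc field_simps
        del: of_nat_Suc)
qed

text \<open>The product on the left is annihilated by the operator with parameters
  \<open>r - p\<close>, \<open>r - q\<close>, \<open>r\<close> and has constant term 1; such a
  solution is unique.\<close>

lemma hypergeo_fps_Euler:
  assumes r: "r \<notin> \<int>\<^sub>\<le>\<^sub>0"
  shows "one_minus_X_powr (r - p - q) * hypergeo_fps p q r = hypergeo_fps (r - p) (r - q) r"
proof -
  define F E where "F = hypergeo_fps p q r" and "E = one_minus_X_powr (r - p - q)"
  define G where "G = E * F"
  define s where "s = fps_const (r - p - q)"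
  define P Q R where "P = fps_const p" and "Q = fps_const q" and "R = fps_const r"
  define F' F'' E' E'' where "F' = fps_deriv F" and "F'' = fps_deriv F'"
    and "E' = fps_deriv E" and "E'' = fps_deriv E'"
  define X :: "real fps" where "X = fps_X"
  have s: "s = R - P - Q"
    by (simp add: s_def P_def Q_def R_def)
  have E': "(1 - X) * E' = s * E"
    using one_minus_X_powr_deriv by (simp add: X_def E'_def E_def s_def)
  then have "fps_deriv ((1 - X) * E') = fps_deriv (s * E)"
    by simp
  then have E'': "(1 - X) * E'' = (s + 1) * E'"
    by (simp add: X_def E''_def E'_def s_def algebra_simps)
  have "hypergeo_ode p q r F = 0"
    by (subst hypergeo_ode_eq_0_iff[OF r, of _ 1]) (simp_all add: F_def hypergeo_fps_def)
  then have ode: "X * F'' - X * (X * F'') + R * F' - (P + Q + 1) * (X * F') - P * Q * F = 0"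
    by (simp add: hypergeo_ode_def F''_def F'_def P_def Q_def R_def X_def)
  then have ode': "X * F'' - X * (X * F'') = (P + Q + 1) * (X * F') + P * Q * F - R * F'"
    by (simp add: algebra_simps)
  have G': "fps_deriv G = E' * F + E * F'"
    by (simp add: G_def E'_def F'_def)
  have G'': "fps_deriv (fps_deriv G) = E'' * F + 2 * E' * F' + E * F''"
    by (simp add: G' E''_def F''_def) (simp add: E'_def F'_def algebra_simps)
  have PQ: "fps_const (r - p) = R - P" "fps_const (r - q) = R - Q"
    by (simp_all add: P_def Q_def R_def)
  have E''2: "(1 - X) * (1 - X) * E'' = s * (s + 1) * E"
    using E' E'' by algebra
  \<comment> \<open>The extra factor \<open>1 - X\<close> allows the derivatives of \<open>E\<close>
    to be eliminated by \<open>E'\<close> and \<open>E''2\<close> and the second derivative of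
    \<open>F\<close> by \<open>ode'\<close>, all without division. It is cancelled at the end,
    formal series having no zero divisors.\<close>
  have "(1 - X) * hypergeo_ode (r - p) (r - q) r G
      = X * ((1 - X) * (1 - X) * E'') * F + 2 * X * ((1 - X) * ((1 - X) * E')) * F'
        + (R - (R - P + (R - Q) + 1) * X) * ((1 - X) * E') * F - (1 - X) * (R - P) * (R - Q) * E * F
        + (1 - X) * E * (X * F'' - X * (X * F'') + (R - (R - P + (R - Q) + 1) * X) * F')"
    unfolding hypergeo_ode_def PQ G''
    unfolding G' X_def[symmetric] R_def[symmetric]
    unfolding G_def
    by (simp add: algebra_simps)
  also have "\<dots> = X * (s * (s + 1) * E) * F + 2 * X * ((1 - X) * (s * E)) * F'
        + (R - (R - P + (R - Q) + 1) * X) * (s * E) * F - (1 - X) * (R - P) * (R - Q) * E * F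
        + (1 - X) * E * (((P + Q + 1) * (X * F') + P * Q * F - R * F')
            + (R - (R - P + (R - Q) + 1) * X) * F')"
    unfolding E' E''2 ode' ..
  also have "\<dots> = 0"
    unfolding s by (simp add: algebra_simps)
  finally have "(1 - X) * hypergeo_ode (r - p) (r - q) r G = 0" .
  moreover have "1 - X \<noteq> 0"
    unfolding X_def fps_eq_iff by (auto intro!: exI[of _ 0])
  ultimately have "hypergeo_ode (r - p) (r - q) r G = 0"
    by simp
  moreover have "fps_nth G 0 = 1"
    by (simp add: G_def E_def F_def hypergeo_fps_def one_minus_X_powr_def)
  ultimately have "G = hypergeo_fps (r - p) (r - q) r"
    using hypergeo_ode_eq_0_iff[OF r, of G 1] by (metis fps_const_1_eq_1 mult_1)
  then show ?thesis
    by (simp add: G_def E_def F_def)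
qed

lemma binomial_series_sums:
  fixes s z :: real
  assumes "\<bar>z\<bar> < 1"
  shows "(\<lambda>n. pochhammer s n / fact n * z ^ n) sums (1 - z) powr (- s)"
proof -
  have "(- s gchoose n) * (- z) ^ n = pochhammer s n / fact n * z ^ n" for n
    by (simp add: gbinomial_pochhammer mult.commute mult.left_commute flip: power_mult_distrib)
  then show ?thesis
    using gen_binomial_real[of "- z" "- s"] assms by simp
qed

text \<open>Both factors converge absolutely for \<bar>x\<bar> < 1, so their Cauchy product carries
  the formal identity over to values.\<close>

theorem hypergeo_2F1_Euler:
  assumes r: "r \<notin> \<int>\<^sub>\<le>\<^sub>0" and x: "\<bar>x\<bar> < 1"
  shows "hypergeo_2F1 p q r x = (1 - x) powr (r - p - q) * hypergeo_2F1 (r - p) (r - q) r x"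
proof -
  let ?s = "r - p - q"
  \<comment> \<open>With second and third parameter both 1, the hypergeometric coefficients reduce
    to those of the binomial series.\<close>
  have abs: "summable (\<lambda>n. norm (pochhammer ?s n / fact n * x ^ n))"
    using hypergeo_summable_abs[of 1 x ?s 1] x
    by (simp add: hypergeo_coeff_def pochhammer_fact[symmetric])
  have "(\<lambda>n. \<Sum>i\<le>n. (pochhammer ?s i / fact i * x ^ i) * (hypergeo_coeff p q r (n - i) * x ^ (n - i)))
      sums ((\<Sum>n. pochhammer ?s n / fact n * x ^ n) * (\<Sum>n. hypergeo_coeff p q r n * x ^ n))"
    using hypergeo_summable_abs[OF r x] by (intro Cauchy_product_sums abs) simp
  moreover have "(\<Sum>i\<le>n. (pochhammer ?s i / fact i * x ^ i) * (hypergeo_coeff p q r (n - i) * x ^ (n - i)))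
      = hypergeo_coeff (r - p) (r - q) r n * x ^ n" for n
  proof -
    have "(\<Sum>i\<le>n. (pochhammer ?s i / fact i * x ^ i) * (hypergeo_coeff p q r (n - i) * x ^ (n - i)))
      = (\<Sum>i\<le>n. pochhammer ?s i / fact i * hypergeo_coeff p q r (n - i)) * x ^ n"
    proof (unfold sum_distrib_right, rule sum.cong)
      fix i assume "i \<in> {..n}"
      then have "x ^ n = x ^ i * x ^ (n - i)"
        by (simp flip: power_add)
      then show "pochhammer ?s i / fact i * x ^ i * (hypergeo_coeff p q r (n - i) * x ^ (n - i))
          = pochhammer ?s i / fact i * hypergeo_coeff p q r (n - i) * x ^ n"
        by simp
    qed simp
    also have "(\<Sum>i\<le>n. pochhammer ?s i / fact i * hypergeo_coeff p q r (n - i))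
        = fps_nth (one_minus_X_powr ?s * hypergeo_fps p q r) n"
      by (simp add: fps_mult_nth one_minus_X_powr_def hypergeo_fps_def atMost_atLeast0)
    finally show ?thesis
      by (simp only: hypergeo_fps_Euler[OF r]) (simp add: hypergeo_fps_def)
  qed
  ultimately have "(\<lambda>n. hypergeo_coeff (r - p) (r - q) r n * x ^ n) sums
      ((1 - x) powr - ?s * hypergeo_2F1 p q r x)"
    using binomial_series_sums[OF x, of ?s] by (simp add: sums_iff hypergeo_2F1_eq)
  then have "hypergeo_2F1 (r - p) (r - q) r x = (1 - x) powr - ?s * hypergeo_2F1 p q r x"
    using hypergeo_sums[OF r x] sums_unique2 by blast
  moreover have "(1 - x) powr ?s * (1 - x) powr - ?s = 1"
    using x by (subst powr_add[symmetric]) simp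
  ultimately show ?thesis
    by (metis mult.assoc mult_1)
qed

section \<open>Beta-hypergeometric distributions\<close>

lemma not_nonpos_Ints: "(x::real) > 0 \<Longrightarrow> x \<notin> \<int>\<^sub>\<le>\<^sub>0"
  by (auto elim!: nonpos_Ints_cases)

lemma Beta_pos:
  fixes a b :: real
  shows "a > 0 \<Longrightarrow> b > 0 \<Longrightarrow> Beta a b > 0"
  by (simp add: Beta_def Gamma_real_pos)

lemma Beta_add_of_nat:
  fixes a b :: real
  assumes "a > 0" "b > 0"
  shows "Beta (a + real n) b = Beta a b * pochhammer a n / pochhammer (a + b) n"
proof (induction n)
  case (Suc n)
  have "(a + n + b) * Beta (a + n + 1) b = (a + n) * Beta (a + n) b"
    using assms by (intro Beta_plus1_left not_nonpos_Ints) auto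
  then have "Beta (a + real (Suc n)) b = (a + n) * Beta (a + n) b / (a + b + n)"
    using assms by (simp add: divide_simps mult_ac add_ac)
  then show ?case
    by (simp add: Suc pochhammer_Suc mult_ac)
qed simp

lemma has_bochner_integral_Beta:
  fixes a b :: real
  assumes "a > 0" "b > 0"
  shows "has_bochner_integral lborel
    (\<lambda>x. indicator {0<..<1} x * (x powr (a - 1) * (1 - x) powr (b - 1))) (Beta a b)"
proof (rule has_bochner_integral_nn_integral)
  have "((\<lambda>t. t powr (a - 1) * (1 - t) powr (b - 1)) has_integral Beta a b) {0<..<1}"
    using has_integral_Beta_real[OF assms] by (simp add: has_integral_Icc_iff_Ioo)
  then show "(\<integral>\<^sup>+x. ennreal (indicator {0<..<1} x * (x powr (a - 1) * (1 - x) powr (b - 1))) \<partial>lborel)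
      = ennreal (Beta a b)"
    by (intro nn_integral_has_integral_lebesgue) auto
qed (use Beta_pos[OF assms] in auto)

lemma borel_measurable_hypergeo_2F1 [measurable]: "hypergeo_2F1 p q r \<in> borel_measurable borel"
  unfolding hypergeo_2F1_eq by measurable

lemma borel_measurable_BH_kernel [measurable]: "BH_kernel s \<in> borel_measurable borel"
proof -
  obtain a b p q r where s: "s = (a, b, p, q, r)" by (cases s)
  have "BH_kernel s = (\<lambda>x. x powr (a - 1) * (1 - x) powr (b - 1) * hypergeo_2F1 p q r x)"
    by (simp add: s fun_eq_iff)
  then show ?thesis by simp
qed

text \<open>Integrating the series termwise gives Beta integrals. The interchange is justified by
  absolute summability of the results, which have order \<open>n powr (p + q - r - b - 1)\<close>;
  this is where \<open>r + b - p - q > 0\<close> enters.\<close>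

lemma has_bochner_integral_BH_kernel:
  assumes ab: "a > 0" "b > 0" and r: "r \<notin> \<int>\<^sub>\<le>\<^sub>0" and pq: "r + b - p - q > 0"
  shows "has_bochner_integral lborel (\<lambda>x. indicator {0<..<1} x * BH_kernel (a, b, p, q, r) x)
    (\<Sum>n. hypergeo_coeff p q r n * Beta (a + real n) b)"
proof -
  let ?u = "hypergeo_coeff p q r"
  define g where "g n x = indicator {0<..<1} x * (x powr (a + real n - 1) * (1 - x) powr (b - 1))" for n x
  define f where "f n x = ?u n * g n x" for n x
  have g: "has_bochner_integral lborel (g n) (Beta (a + real n) b)" for n
    unfolding g_def using ab by (intro has_bochner_integral_Beta) auto
  then have f: "has_bochner_integral lborel (f n) (?u n * Beta (a + real n) b)" for n
    unfolding f_def by (intro has_bochner_integral_mult_right) auto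
  have g_nonneg: "g n x \<ge> 0" for n x
    by (simp add: g_def)
  have g_sums: "(\<lambda>n. f n x) sums (indicator {0<..<1} x * BH_kernel (a, b, p, q, r) x)"
    and g_abs: "summable (\<lambda>n. norm (f n x))" for x
  proof -
    have f_eq: "f n x = indicator {0<..<1} x * (x powr (a - 1) * (1 - x) powr (b - 1)) * (?u n * x ^ n)" for n
      by (auto simp: f_def g_def indicator_def powr_add powr_diff powr_realpow)
    show "(\<lambda>n. f n x) sums (indicator {0<..<1} x * BH_kernel (a, b, p, q, r) x)"
    proof (cases "x \<in> {0<..<1}")
      case True
      then show ?thesis
        unfolding f_eq
        using sums_mult[OF hypergeo_sums[OF r, of x p q], of "x powr (a - 1) * (1 - x) powr (b - 1)"]
        by (simp add: mult_ac)
    qed (simp add: f_eq)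
    show "summable (\<lambda>n. norm (f n x))"
    proof (cases "x \<in> {0<..<1}")
      case True
      then show ?thesis
        unfolding f_eq abs_mult real_norm_def
        using summable_mult[OF hypergeo_summable_abs[OF r, of x p q],
            of "x powr (a - 1) * (1 - x) powr (b - 1)"]
        by (simp add: abs_mult)
    qed (simp add: f_eq)
  qed
  \<comment> \<open>By \<open>Beta_add_of_nat\<close>, the factor \<open>Beta (a + n) b\<close>
    contributes the quotient of \<open>pochhammer a n\<close> by
    \<open>pochhammer (a + b) n\<close>, hence a further power \<open>- b\<close> of
    \<open>n\<close>.\<close>
  have "(\<lambda>n. ?u n / real n powr (p + q - r - 1) * (pochhammer a n / (fact n * real n powr (a - 1)))
      / (pochhammer (a + b) n / (fact n * real n powr (a + b - 1))))
      \<longlonglongrightarrow> (rGamma p * rGamma q / rGamma r) * rGamma a / rGamma (a + b)"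
    using ab by (intro tendsto_intros hypergeo_coeff_asymp[OF r] pochhammer_asymp)
      (simp add: rGamma_eq_zero_iff not_nonpos_Ints)
  moreover have "\<forall>\<^sub>F n in sequentially. ?u n / real n powr (p + q - r - 1)
      * (pochhammer a n / (fact n * real n powr (a - 1)))
      / (pochhammer (a + b) n / (fact n * real n powr (a + b - 1)))
    = (?u n * pochhammer a n / pochhammer (a + b) n) / real n powr (p + q - r - b - 1)"
    using eventually_gt_at_top[of 0]
  proof eventually_elim
    case (elim n)
    moreover have "p + q - r - b - 1 = (p + q - r - 1) + (a - 1) - (a + b - 1)" by simp
    ultimately show ?case
      by (simp only: powr_diff powr_add) (simp add: divide_simps)
  qed
  ultimately have "(\<lambda>n. (?u n * pochhammer a n / pochhammer (a + b) n) / real n powr (p + q - r - b - 1))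
      \<longlonglongrightarrow> (rGamma p * rGamma q / rGamma r) * rGamma a / rGamma (a + b)"
    by (rule Lim_transform_eventually)
  then have "summable (\<lambda>n. \<bar>?u n * pochhammer a n / pochhammer (a + b) n\<bar>)"
    using pq by (intro summable_powr_asymp) auto
  then have "summable (\<lambda>n. Beta a b * \<bar>?u n * pochhammer a n / pochhammer (a + b) n\<bar>)"
    by (rule summable_mult)
  then have abs: "summable (\<lambda>n. \<bar>?u n * Beta (a + real n) b\<bar>)"
    using Beta_pos[OF ab] by (simp add: Beta_add_of_nat[OF ab] abs_mult mult_ac)
  \<comment> \<open>The functions \<open>g n\<close> do not change sign, so the L1 norm of
    \<open>f n\<close> is the absolute value of its integral.\<close>
  have norm: "(\<integral>x. norm (f n x) \<partial>lborel) = \<bar>?u n * Beta (a + real n) b\<bar>" for n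
  proof -
    have "Beta (a + real n) b > 0" using ab by (intro Beta_pos) auto
    moreover have "has_bochner_integral lborel (\<lambda>x. \<bar>?u n\<bar> * g n x) (\<bar>?u n\<bar> * Beta (a + real n) b)"
      using g by (intro has_bochner_integral_mult_right) auto
    ultimately show ?thesis
      using g_nonneg by (simp add: f_def abs_mult has_bochner_integral_iff)
  qed
  have int: "integrable lborel (f n)" for n
    using f by (simp add: has_bochner_integral_iff)
  have sm: "summable (\<lambda>n. \<integral>x. norm (f n x) \<partial>lborel)"
    unfolding norm by (rule abs)
  have "(\<lambda>n. integral\<^sup>L lborel (f n)) sums (\<integral>x. (\<Sum>n. f n x) \<partial>lborel)"
    by (rule sums_integral[OF int _ sm]) (rule AE_I2, rule g_abs)
  moreover have "integrable lborel (\<lambda>x. \<Sum>n. f n x)"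
    by (rule integrable_suminf[OF int _ sm]) (rule AE_I2, rule g_abs)
  moreover have "integral\<^sup>L lborel (f n) = ?u n * Beta (a + real n) b" for n
    using f by (simp add: has_bochner_integral_iff)
  moreover have "(\<Sum>n. f n x) = indicator {0<..<1} x * BH_kernel (a, b, p, q, r) x" for x
    using g_sums by (simp add: sums_iff)
  ultimately show ?thesis
    by (simp add: has_bochner_integral_iff sums_iff)
qed

section \<open>Normalisation of the densities\<close>

lemma BH_kernel_pos:
  "s \<in> BH_params \<Longrightarrow> 0 < x \<Longrightarrow> x < 1 \<Longrightarrow> BH_kernel s x > 0"
  by (auto simp: BH_params_def)

lemma BH_kernel_integrable:
  "s \<in> BH_params \<Longrightarrow> integrable lborel (\<lambda>x. indicator {0<..<1} x * BH_kernel s x)"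
  by (cases s) (auto simp: BH_params_def has_bochner_integral_iff[THEN iffD1, OF has_bochner_integral_BH_kernel]
      simp del: BH_kernel.simps)

text \<open>A vanishing integral would make the kernel vanish almost everywhere on the unit
  interval, which has positive measure.\<close>

lemma BH_kernel_integral_pos:
  assumes "\<And>x. 0 < x \<Longrightarrow> x < 1 \<Longrightarrow> BH_kernel s x > 0"
    and int: "integrable lborel (\<lambda>x. indicator {0<..<1} x * BH_kernel s x)"
  shows "(\<integral>x. indicator {0<..<1} x * BH_kernel s x \<partial>lborel) > 0"
proof -
  have nonneg: "indicator {0<..<1} x * BH_kernel s x \<ge> 0" for x
    using assms(1)[of x] by (auto simp: indicator_def intro: less_imp_le)
  have "(\<integral>x. indicator {0<..<1} x * BH_kernel s x \<partial>lborel) \<noteq> 0"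
  proof
    assume "(\<integral>x. indicator {0<..<1} x * BH_kernel s x \<partial>lborel) = 0"
    then have "AE x in lborel. indicator {0<..<1} x * BH_kernel s x = 0"
      using integral_nonneg_eq_0_iff_AE[OF int] nonneg by simp
    then have "AE x in lborel. x \<notin> {0<..<1::real}"
      by eventually_elim (use assms(1) in \<open>force simp: indicator_def\<close>)
    then have "emeasure lborel {0<..<1::real} = 0"
      by (subst (asm) AE_iff_measurable[of "{0<..<1}"]) auto
    then show False by simp
  qed
  then show ?thesis
    using Bochner_Integration.integral_nonneg[of lborel "\<lambda>x. indicator {0<..<1} x * BH_kernel s x"] nonneg
    by (simp add: less_le)
qed

lemma BH_eq:
  "BH s = density lborel (\<lambda>x. ennreal (indicator {0<..<1} x * BH_kernel s x
      / (\<integral>y. indicator {0<..<1} y * BH_kernel s y \<partial>lborel)))"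
  by (simp add: BH_def set_lebesgue_integral_def)

lemma sets_BH [simp, measurable_cong]: "sets (BH s) = sets borel"
  by (simp add: BH_eq)

lemma space_BH [simp]: "space (BH s) = UNIV"
  by (simp add: BH_eq)

lemma BH_cong:
  assumes "\<And>x. 0 < x \<Longrightarrow> x < 1 \<Longrightarrow> BH_kernel s x = BH_kernel s' x"
  shows "BH s = BH s'"
proof -
  have "(\<lambda>x. indicator {0<..<1} x * BH_kernel s x) = (\<lambda>x. indicator {0<..<1} x * BH_kernel s' x)"
    using assms by (auto simp: indicator_def)
  then show ?thesis
    unfolding BH_eq by metis
qed

lemma prob_space_BH:
  assumes s: "s \<in> BH_params"
  shows "prob_space (BH s)"
proof (rule prob_spaceI)
  let ?f = "\<lambda>x. indicator {0<..<1} x * BH_kernel s x"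
  let ?Z = "\<integral>x. ?f x \<partial>lborel"
  have int: "integrable lborel ?f"
    by (rule BH_kernel_integrable[OF s])
  have Z: "?Z > 0"
    by (intro BH_kernel_integral_pos BH_kernel_pos[OF s] int)
  have f: "?f x \<ge> 0" for x
    using BH_kernel_pos[OF s, of x] by (auto simp: indicator_def intro: less_imp_le)
  have "emeasure (BH s) (space (BH s)) = (\<integral>\<^sup>+x. ennreal (?f x / ?Z) \<partial>lborel)"
    by (simp add: BH_eq emeasure_density)
  also have "\<dots> = ennreal (\<integral>x. ?f x / ?Z \<partial>lborel)"
    using f Z by (intro nn_integral_eq_integral integrable_divide_zero int) auto
  also have "\<dots> = 1"
    using Z by simp
  finally show "emeasure (BH s) (space (BH s)) = 1" .
qed

text \<open>The constant of a probability density proportional to the kernel is forced, so a law can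
  be identified as \<open>BH s\<close> without evaluating its normalising constant.\<close>

lemma BH_unique:
  assumes prob: "prob_space (density lborel (\<lambda>x. ennreal (C * (indicator {0<..<1} x * BH_kernel s x))))"
    and C: "C > 0" and nonneg: "\<And>x. 0 < x \<Longrightarrow> x < 1 \<Longrightarrow> BH_kernel s x \<ge> 0"
  shows "density lborel (\<lambda>x. ennreal (C * (indicator {0<..<1} x * BH_kernel s x))) = BH s"
proof -
  let ?f = "\<lambda>x. indicator {0<..<1} x * BH_kernel s x"
  have f: "?f x \<ge> 0" for x
    using nonneg[of x] by (auto simp: indicator_def)
  have "(\<integral>\<^sup>+x. ennreal (C * ?f x) \<partial>lborel) = ennreal 1"
    using prob_space.emeasure_space_1[OF prob] by (simp add: emeasure_density)
  then have "has_bochner_integral lborel (\<lambda>x. C * ?f x) 1"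
    using f C by (intro has_bochner_integral_nn_integral) auto
  then have "has_bochner_integral lborel (\<lambda>x. 1 / C * (C * ?f x)) (1 / C * 1)"
    by (intro has_bochner_integral_mult_right) auto
  then have "integral\<^sup>L lborel ?f = 1 / C"
    using C by (simp add: has_bochner_integral_iff)
  then show ?thesis
    unfolding BH_eq by (simp add: mult.commute)
qed

text \<open>When the first and last parameters agree, the Pochhammer symbols of \<open>r\<close> in
  the Beta factor and in the coefficient cancel. What is left is a hypergeometric series at 1 with
  lower parameter \<open>r + b\<close>.\<close>

lemma has_bochner_integral_BH_kernel_self:
  assumes "r > 0" "b > 0" "r + b - p - q > 0"
  shows "has_bochner_integral lborel (\<lambda>x. indicator {0<..<1} x * BH_kernel (r, b, p, q, r) x)
    (Beta r b * (\<Sum>n. hypergeo_coeff p q (r + b) n))"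
proof -
  have eq: "hypergeo_coeff p q r n * Beta (r + real n) b = Beta r b * hypergeo_coeff p q (r + b) n" for n
    using pochhammer_nonzero[OF not_nonpos_Ints[OF assms(1)], of n]
    by (simp add: Beta_add_of_nat assms hypergeo_coeff_def)
  have "summable (hypergeo_coeff p q (r + b))"
    using assms by (intro summable_rabs_cancel[OF hypergeo_coeff_summable_abs] not_nonpos_Ints) auto
  then show ?thesis
    using has_bochner_integral_BH_kernel[of r b r p q] assms
    by (simp add: eq suminf_mult not_nonpos_Ints del: BH_kernel.simps)
qed

text \<open>Raising \<open>b\<close> by 1 raises the lower parameter of the series at 1 by 1, so
  each step is one use of \<open>hypergeo_at_1_contiguous\<close> and one of the Beta recurrence.
  The form is free of quotients because the hypotheses allow the Pochhammer factors on the left to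
  vanish.\<close>

lemma BH_kernel_moments:
  assumes rb: "r > 0" "b > 0" and pq: "r + b - p - q > 0"
  defines "I \<equiv> \<lambda>n. \<integral>x. indicator {0<..<1} x * BH_kernel (r, b + real n, p, q, r) x \<partial>lborel"
  shows "I n * (pochhammer (r + b - p) n * pochhammer (r + b - q) n)
    = I 0 * (pochhammer b n * pochhammer (r + b - p - q) n)"
proof (induction n)
  case (Suc n)
  define c where "c = r + b + real n"
  have I: "I m = Beta r (b + real m) * (\<Sum>k. hypergeo_coeff p q (r + b + real m) k)" for m
    using has_bochner_integral_BH_kernel_self[of r "b + real m" p q] rb pq
    by (simp add: I_def has_bochner_integral_iff add.assoc del: BH_kernel.simps)
  have "(c - p) * (c - q) * (\<Sum>k. hypergeo_coeff p q (c + 1) k)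
      = c * (c - p - q) * (\<Sum>k. hypergeo_coeff p q c k)"
    using rb pq by (intro hypergeo_at_1_contiguous not_nonpos_Ints) (auto simp: c_def)
  moreover have "(r + (b + real n)) * Beta r ((b + real n) + 1) = (b + real n) * Beta r (b + real n)"
    using rb by (intro Beta_plus1_right not_nonpos_Ints) auto
  then have "c * Beta r (b + real n + 1) = (b + real n) * Beta r (b + real n)"
    by (simp add: c_def add.assoc)
  moreover have "c > 0"
    using rb by (simp add: c_def)
  ultimately have "I (Suc n) * ((c - p) * (c - q)) = I n * ((b + real n) * (c - p - q))"
    by (simp add: I c_def add_ac) algebra
  with Suc.IH show ?case
    by (simp add: pochhammer_Suc c_def) algebra
qed simp

section \<open>The image of a beta-hypergeometric distribution under a random map\<close>

lemma ennreal_eqI: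
  assumes "\<And>I. I \<ge> 0 \<Longrightarrow> x = ennreal I \<longleftrightarrow> y = ennreal I"
  shows "x = y"
  using assms by (metis ennreal_cases)

lemma nn_integral_eq_iff_absolutely_integrable:
  fixes f :: "real \<Rightarrow> real"
  assumes [measurable]: "f \<in> borel_measurable borel" "S \<in> sets borel"
    and f: "\<And>x. x \<in> S \<Longrightarrow> 0 \<le> f x" and I: "0 \<le> I"
  shows "(\<integral>\<^sup>+x. ennreal (f x) * indicator S x \<partial>lborel) = ennreal I
    \<longleftrightarrow> f absolutely_integrable_on S \<and> integral S f = I"
proof
  assume *: "(\<integral>\<^sup>+x. ennreal (f x) * indicator S x \<partial>lborel) = ennreal I"
  have "has_bochner_integral lborel (\<lambda>x. indicator S x *\<^sub>R f x) I"
  proof (rule has_bochner_integral_nn_integral)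
    show "(\<integral>\<^sup>+x. ennreal (indicator S x *\<^sub>R f x) \<partial>lborel) = ennreal I"
      unfolding *[symmetric] by (intro nn_integral_cong) (auto simp: indicator_def)
  qed (use f I in \<open>auto simp: indicator_def\<close>)
  then have "has_bochner_integral lebesgue (\<lambda>x. indicator S x *\<^sub>R f x) I"
    by (simp add: has_bochner_integral_iff integrable_completion integral_completion)
  then have "f absolutely_integrable_on S" "(LINT x:S|lebesgue. f x) = I"
    by (simp_all add: has_bochner_integral_iff set_integrable_def set_lebesgue_integral_def)
  then show "f absolutely_integrable_on S \<and> integral S f = I"
    using set_lebesgue_integral_eq_integral(2) by metis
next
  assume "f absolutely_integrable_on S \<and> integral S f = I"
  then have "(f has_integral I) S"
    using set_lebesgue_integral_eq_integral(1) integrable_integral by blast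
  then show "(\<integral>\<^sup>+x. ennreal (f x) * indicator S x \<partial>lborel) = ennreal I"
    using f by (intro nn_integral_has_integral_lebesgue') auto
qed

text \<open>The substitution rule for absolutely integrable functions is applied at each finite
  candidate value \<open>I\<close>. By \<open>ennreal_eqI\<close> this settles the infinite case
  too, so \<open>f\<close> need not be known to be integrable beforehand.\<close>

lemma nn_integral_change_of_variables:
  fixes f g g' :: "real \<Rightarrow> real"
  assumes S [measurable]: "S \<in> sets borel" and gS [measurable]: "g ` S \<in> sets borel"
    and [measurable]: "f \<in> borel_measurable borel" "g \<in> borel_measurable borel" "g' \<in> borel_measurable borel"
    and der: "\<And>x. x \<in> S \<Longrightarrow> (g has_field_derivative g' x) (at x within S)"
    and inj: "inj_on g S" and f: "\<And>x. x \<in> g ` S \<Longrightarrow> f x \<ge> 0"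
  shows "(\<integral>\<^sup>+x. ennreal (\<bar>g' x\<bar> * f (g x)) * indicator S x \<partial>lborel)
    = (\<integral>\<^sup>+y. ennreal (f y) * indicator (g ` S) y \<partial>lborel)" (is "?L = ?R")
proof -
  have "?L = ennreal I \<longleftrightarrow> ?R = ennreal I" if "I \<ge> 0" for I
  proof -
    have "?L = ennreal I \<longleftrightarrow> (\<lambda>x. \<bar>g' x\<bar> * f (g x)) absolutely_integrable_on S
        \<and> integral S (\<lambda>x. \<bar>g' x\<bar> * f (g x)) = I"
      using f that by (intro nn_integral_eq_iff_absolutely_integrable) auto
    also have "\<dots> \<longleftrightarrow> f absolutely_integrable_on (g ` S) \<and> integral (g ` S) f = I"
      using S by (intro has_absolute_integral_change_of_variables_1' der inj) auto
    also have "\<dots> \<longleftrightarrow> ?R = ennreal I"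
      using f that by (intro nn_integral_eq_iff_absolutely_integrable[symmetric]) auto
    finally show ?thesis .
  qed
  then show ?thesis
    by (rule ennreal_eqI)
qed

section \<open>The image of the beta distribution of the second kind under one map\<close>

lemma sets_beta2 [simp, measurable_cong]: "sets (beta2 c d) = sets borel"
  by (simp add: beta2_def)

lemma space_beta2 [simp]: "space (beta2 c d) = UNIV"
  by (simp add: beta2_def)

text \<open>The density at \<open>y\<close> of \<open>H w x\<close> for fixed \<open>x\<close> and
  \<open>w\<close> distributed as \<open>beta2 c d\<close>, arranged so that \<open>x\<close> and
  \<open>y\<close> meet only in the last denominator.\<close>

definition H_density :: "real \<Rightarrow> real \<Rightarrow> real \<Rightarrow> real \<Rightarrow> real" where
  "H_density c d x y = 1 / Beta c d * (x powr d * (y powr (d - 1) * (1 - y) powr (c - 1)))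
     / (1 - (1 - x) * y) powr (c + d)"

lemma distr_beta2_H:
  assumes cd: "c > 0" "d > 0" and x: "x > 0"
  shows "distr (beta2 c d) borel (\<lambda>w. H w x)
    = density lborel (\<lambda>y. ennreal (indicator {0<..<1} y * H_density c d x y))"
proof (rule measure_eqI)
  fix A assume "A \<in> sets (distr (beta2 c d) borel (\<lambda>w. H w x))"
  then have [measurable]: "A \<in> sets borel" by simp
  have [measurable]: "(\<lambda>w. H w x) \<in> borel_measurable borel"
    unfolding H_def by measurable
  define h where "h w = 1 / Beta c d * (w powr (c - 1) / (1 + w) powr (c + d))" for w :: real
  have [measurable]: "h \<in> borel_measurable borel"
    unfolding h_def by measurable
  have h: "h w \<ge> 0" for w
    using Beta_pos[OF cd] by (simp add: h_def)
  \<comment> \<open>The inverse of \<open>w \<mapsto> H w x\<close>, mapping the open unit interval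
    onto the positive half-line.\<close>
  define g where "g y = (1 - y) / (x * y)" for y
  have [measurable]: "g \<in> borel_measurable borel"
    unfolding g_def by measurable
  define f where "f w = h w * indicator A (H w x)" for w
  have Hg: "H (g y) x = y" if "y > 0" for y
    using that x by (simp add: H_def g_def divide_simps)
  have img: "g ` {0<..<1} = {0<..}"
  proof
    show "g ` {0<..<1} \<subseteq> {0<..}"
      using x by (auto simp: g_def)
    show "{0<..} \<subseteq> g ` {0<..<1}"
    proof
      fix w :: real assume "w \<in> {0<..}"
      then have "w * x > 0"
        using x by simp
      then have "w = g (1 / (1 + w * x))" "1 / (1 + w * x) \<in> {0<..<1}"
        using x by (auto simp: g_def divide_simps)
      then show "w \<in> g ` {0<..<1}" by blast
    qed
  qed
  \<comment> \<open>The factor \<open>1 / (x * y\<^sup>2)\<close> is the absolute value of the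
    derivative of \<open>g\<close>.\<close>
  have subst: "1 / (x * y\<^sup>2) * h (g y) = H_density c d x y" if y: "y \<in> {0<..<1}" for y
  proof -
    have y': "0 < y" "y < 1" using y by auto
    have pos: "1 - (1 - x) * y > 0"
      using mult_pos_pos[OF x y'(1)] y' by (simp add: algebra_simps)
    have "1 + g y = (1 - (1 - x) * y) / (x * y)"
      using y x by (simp add: g_def divide_simps) (simp add: algebra_simps)
    then have "1 / (x * y\<^sup>2) * h (g y) = 1 / Beta c d * (((1 - y) powr (c - 1) / (x * y) powr (c - 1))
        * (x * y) powr (c + d) / (1 - (1 - x) * y) powr (c + d) / (x * y\<^sup>2))"
      using y x pos by (simp add: h_def powr_divide) (simp add: g_def powr_divide)
    also have "(x * y) powr (c + d) = (x * y) powr (c - 1) * (x * y) powr d * (x * y)"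
      using y' x powr_add[of "x * y" "c - 1 + d" 1] powr_add[of "x * y" "c - 1" d] by simp
    also have "(x * y) powr d = x powr d * y powr (d - 1) * y"
      using y x by (simp add: powr_mult powr_diff)
    also have "1 / Beta c d * ((1 - y) powr (c - 1) / (x * y) powr (c - 1) *
        ((x * y) powr (c - 1) * (x powr d * y powr (d - 1) * y) * (x * y))
          / (1 - (1 - x) * y) powr (c + d) / (x * y\<^sup>2)) = H_density c d x y"
      using y' x by (simp add: H_density_def power2_eq_square)
    finally show ?thesis .
  qed
  have "emeasure (distr (beta2 c d) borel (\<lambda>w. H w x)) A = (\<integral>\<^sup>+w. indicator A (H w x) \<partial>beta2 c d)"
    by (subst nn_integral_indicator[symmetric], simp, subst nn_integral_distr) auto
  also have "\<dots> = (\<integral>\<^sup>+w. ennreal (indicator {0<..} w * h w) * indicator A (H w x) \<partial>lborel)"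
    unfolding beta2_def h_def[symmetric] by (subst nn_integral_density) auto
  also have "\<dots> = (\<integral>\<^sup>+w. ennreal (f w) * indicator (g ` {0<..<1}) w \<partial>lborel)"
    unfolding img by (intro nn_integral_cong) (auto simp: f_def split: split_indicator)
  also have "\<dots> = (\<integral>\<^sup>+y. ennreal (\<bar>- (1 / (x * y\<^sup>2))\<bar> * f (g y)) * indicator {0<..<1} y \<partial>lborel)"
  proof (rule nn_integral_change_of_variables[symmetric])
    show "g ` {0<..<1} \<in> sets borel"
      by (simp add: img)
    show "f \<in> borel_measurable borel"
      unfolding f_def by measurable
    show "inj_on g {0<..<1}"
      by (rule inj_on_inverseI[of _ "\<lambda>w. H w x"]) (use Hg in auto)
    show "(g has_real_derivative - (1 / (x * y\<^sup>2))) (at y within {0<..<1})" if "y \<in> {0<..<1}" for y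
      unfolding g_def using that x
      by (auto intro!: derivative_eq_intros simp: divide_simps power2_eq_square) (simp add: algebra_simps)
  qed (use h in \<open>auto simp: f_def\<close>)
  also have "\<dots> = (\<integral>\<^sup>+y. ennreal (indicator {0<..<1} y * H_density c d x y) * indicator A y \<partial>lborel)"
  proof (intro nn_integral_cong)
    fix y :: real
    show "ennreal (\<bar>- (1 / (x * y\<^sup>2))\<bar> * f (g y)) * indicator {0<..<1} y
        = ennreal (indicator {0<..<1} y * H_density c d x y) * indicator A y"
    proof (cases "y \<in> {0<..<1}")
      case True
      then have "\<bar>- (1 / (x * y\<^sup>2))\<bar> * f (g y) = H_density c d x y * indicator A y"
        using subst[OF True, symmetric] x by (simp add: f_def Hg)
      with True show ?thesis by (auto split: split_indicator)
    qed simp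
  qed
  also have "\<dots> = emeasure (density lborel (\<lambda>y. ennreal (indicator {0<..<1} y * H_density c d x y))) A"
    by (subst emeasure_density) (auto simp: H_density_def)
  finally show "emeasure (distr (beta2 c d) borel (\<lambda>w. H w x)) A = \<dots>" .
qed simp

text \<open>At \<open>x = 1\<close> the mixed denominator of \<open>H_density\<close> is 1 and the
  image law is an ordinary Beta law with parameters \<open>d\<close> and \<open>c\<close>; taking
  images preserves total mass.\<close>

lemma prob_space_beta2:
  assumes cd: "c > 0" "d > 0"
  shows "prob_space (beta2 c d)"
proof (rule prob_spaceI)
  have [measurable]: "(\<lambda>w. H w 1) \<in> borel_measurable borel"
    unfolding H_def by measurable
  have "emeasure (beta2 c d) (space (beta2 c d)) = emeasure (distr (beta2 c d) borel (\<lambda>w. H w 1)) UNIV"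
    by (subst emeasure_distr) auto
  also have "\<dots> = (\<integral>\<^sup>+y. ennreal (1 / Beta c d *
      (indicator {0<..<1} y * (y powr (d - 1) * (1 - y) powr (c - 1)))) \<partial>lborel)"
    by (subst distr_beta2_H[OF cd], simp, subst emeasure_density)
      (auto simp: H_density_def mult_ac intro!: nn_integral_cong split: split_indicator)
  also have "\<dots> = ennreal (1 / Beta c d * Beta d c)"
  proof -
    have "has_bochner_integral lborel (\<lambda>y. 1 / Beta c d *
      (indicator {0<..<1} y * (y powr (d - 1) * (1 - y) powr (c - 1)))) (1 / Beta c d * Beta d c)"
      using cd by (intro has_bochner_integral_mult_right has_bochner_integral_Beta) auto
    then show ?thesis
      using Beta_pos[OF cd] by (subst nn_integral_eq_integral) (auto simp: has_bochner_integral_iff)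
  qed
  also have "\<dots> = 1"
    using Beta_pos[OF cd] by (simp add: Beta_commute)
  finally show "emeasure (beta2 c d) (space (beta2 c d)) = 1" .
qed

text \<open>Expanding the binomial factor in powers of \<open>1 - x\<close> turns the integral into the generating
  series of the moments computed in \<open>BH_kernel_moments\<close>.\<close>

lemma nn_integral_BH_kernel_binomial:
  assumes rb: "r > 0" "b > 0" and pq: "r + b - p - q > 0" and q: "r + b - q > 0"
    and pos: "\<And>x. 0 < x \<Longrightarrow> x < 1 \<Longrightarrow> hypergeo_2F1 p q r x > 0"
    and y: "0 < y" "y < 1"
  defines "I \<equiv> \<integral>x. indicator {0<..<1} x * BH_kernel (r, b, p, q, r) x \<partial>lborel"
  shows "I > 0" "r + b - p > 0" "hypergeo_2F1 b (r + b - p - q) (r + b - p) y \<ge> 0"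
    "(\<integral>\<^sup>+x. ennreal (indicator {0<..<1} x * BH_kernel (r, b, p, q, r) x
        / (1 - (1 - x) * y) powr (r + b - q)) \<partial>lborel)
      = ennreal (I * hypergeo_2F1 b (r + b - p - q) (r + b - p) y)"
proof -
  define s where "s = r + b - q"
  define f where "f n x = indicator {0<..<1} x * BH_kernel (r, b + real n, p, q, r) x" for n x
  define J where "J n = (\<integral>x. f n x \<partial>lborel)" for n
  \<comment> \<open>Raising \<open>b\<close> stays inside \<open>BH_params\<close>; this makes every
    moment \<open>J n\<close> finite and positive.\<close>
  have params: "(r, b + real n, p, q, r) \<in> BH_params" for n
    using rb pq pos by (auto simp: BH_params_def not_nonpos_Ints)
  have int: "integrable lborel (f n)" for n
    unfolding f_def by (rule BH_kernel_integrable[OF params])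
  have f_nonneg: "f n x \<ge> 0" for n x
    using BH_kernel_pos[OF params, of x n] by (auto simp: f_def indicator_def simp del: BH_kernel.simps)
  have J_pos: "J n > 0" for n
    unfolding J_def f_def by (intro BH_kernel_integral_pos int[unfolded f_def] BH_kernel_pos[OF params])
  have J0: "J 0 = I"
    by (simp add: J_def f_def I_def del: BH_kernel.simps)
  show I: "I > 0"
    using J_pos[of 0] J0 by simp
  have mom: "J n * (pochhammer (r + b - p) n * pochhammer s n)
      = I * (pochhammer b n * pochhammer (r + b - p - q) n)" for n
    using BH_kernel_moments[OF rb pq, of n] J0
    by (simp add: J_def f_def I_def s_def del: BH_kernel.simps)
  \<comment> \<open>The moment relation for \<open>n = 1\<close> has a positive right-hand side. As
    \<open>J 1\<close> and \<open>s\<close> are positive, it forces \<open>r + b - p > 0\<close>, so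
    the new lower parameter is admissible.\<close>
  have "J 1 * ((r + b - p) * s) > 0"
    using mom[of 1] I rb pq by simp
  with J_pos[of 1] q show rbp: "r + b - p > 0"
    by (simp add: s_def zero_less_mult_iff)
  have poch: "pochhammer (r + b - p) n > 0" "pochhammer s n > 0" for n
    using rbp q by (auto simp: s_def intro: pochhammer_pos)
  have term_eq: "pochhammer s n / fact n * y ^ n * J n
      = I * (hypergeo_coeff b (r + b - p - q) (r + b - p) n * y ^ n)" for n
  proof -
    have "J n = I * (pochhammer b n * pochhammer (r + b - p - q) n) / (pochhammer (r + b - p) n * pochhammer s n)"
      using mom[of n] poch[of n] by (simp add: eq_divide_eq)
    then show ?thesis
      using poch[of n] by (simp add: hypergeo_coeff_def)
  qed
  have sums: "(\<lambda>n. hypergeo_coeff b (r + b - p - q) (r + b - p) n * y ^ n)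
      sums hypergeo_2F1 b (r + b - p - q) (r + b - p) y"
    using rbp y by (intro hypergeo_sums not_nonpos_Ints) auto
  have coeff_nonneg: "hypergeo_coeff b (r + b - p - q) (r + b - p) n * y ^ n \<ge> 0" for n
    using rb pq poch(1)[of n] y pochhammer_pos[of b n] pochhammer_pos[of "r + b - p - q" n]
    by (simp add: hypergeo_coeff_def less_imp_le)
  show "hypergeo_2F1 b (r + b - p - q) (r + b - p) y \<ge> 0"
    using sums_le[OF _ sums_zero sums] coeff_nonneg by simp
  \<comment> \<open>The binomial series of the denominator in powers of \<open>(1 - x) * y\<close>
    has nonnegative terms, so sum and integral may be exchanged by monotone convergence.\<close>
  have "(\<integral>\<^sup>+x. ennreal (indicator {0<..<1} x * BH_kernel (r, b, p, q, r) x / (1 - (1 - x) * y) powr s) \<partial>lborel)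
      = (\<integral>\<^sup>+x. (\<Sum>n. ennreal (pochhammer s n / fact n * y ^ n * f n x)) \<partial>lborel)"
  proof (intro nn_integral_cong suminf_ennreal_eq[symmetric])
    fix x :: real and n
    show "0 \<le> pochhammer s n / fact n * y ^ n * f n x"
      using f_nonneg[of n x] poch(2)[of n] y by (simp add: less_imp_le)
  next
    fix x :: real
    show "(\<lambda>n. pochhammer s n / fact n * y ^ n * f n x) sums
        (indicator {0<..<1} x * BH_kernel (r, b, p, q, r) x / (1 - (1 - x) * y) powr s)"
    proof (cases "x \<in> {0<..<1}")
      case True
      have "\<bar>(1 - x) * y\<bar> < 1 * 1"
        unfolding abs_mult using True y by (intro mult_strict_mono') auto
      from sums_mult[OF binomial_series_sums[of "(1 - x) * y" s], of "BH_kernel (r, b, p, q, r) x"] this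
      have "(\<lambda>n. BH_kernel (r, b, p, q, r) x * (pochhammer s n / fact n * ((1 - x) * y) ^ n)) sums
          (BH_kernel (r, b, p, q, r) x * (1 - (1 - x) * y) powr (- s))"
        by simp
      also have "(\<lambda>n. BH_kernel (r, b, p, q, r) x * (pochhammer s n / fact n * ((1 - x) * y) ^ n))
          = (\<lambda>n. pochhammer s n / fact n * y ^ n * f n x)"
      proof
        fix n
        have "(1 - x) powr (b + real n - 1) = (1 - x) powr (b - 1) * (1 - x) ^ n"
          using True powr_add[of "1 - x" "b - 1" "real n"] by (simp add: powr_realpow algebra_simps)
        then show "BH_kernel (r, b, p, q, r) x * (pochhammer s n / fact n * ((1 - x) * y) ^ n)
            = pochhammer s n / fact n * y ^ n * f n x"
          using True by (simp add: f_def power_mult_distrib)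
      qed
      finally show ?thesis
        using True by (simp add: powr_minus divide_inverse del: BH_kernel.simps)
    qed (simp add: f_def)
  qed
  also have "\<dots> = (\<Sum>n. \<integral>\<^sup>+x. ennreal (pochhammer s n / fact n * y ^ n * f n x) \<partial>lborel)"
    by (intro nn_integral_suminf) (simp add: f_def)
  also have "\<dots> = (\<Sum>n. ennreal (pochhammer s n / fact n * y ^ n * J n))"
  proof (intro suminf_cong)
    fix n
    have "(\<integral>\<^sup>+x. ennreal (pochhammer s n / fact n * y ^ n * f n x) \<partial>lborel)
        = ennreal (\<integral>x. pochhammer s n / fact n * y ^ n * f n x \<partial>lborel)"
      using f_nonneg poch(2)[of n] y
      by (intro nn_integral_eq_integral integrable_mult_right int) (simp add: less_imp_le)
    then show "(\<integral>\<^sup>+x. ennreal (pochhammer s n / fact n * y ^ n * f n x) \<partial>lborel)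
        = ennreal (pochhammer s n / fact n * y ^ n * J n)"
      by (simp add: J_def)
  qed
  also have "\<dots> = ennreal (I * hypergeo_2F1 b (r + b - p - q) (r + b - p) y)"
    unfolding term_eq using coeff_nonneg I by (intro suminf_ennreal_eq sums_mult sums) simp
  finally show "(\<integral>\<^sup>+x. ennreal (indicator {0<..<1} x * BH_kernel (r, b, p, q, r) x
        / (1 - (1 - x) * y) powr (r + b - q)) \<partial>lborel)
      = ennreal (I * hypergeo_2F1 b (r + b - p - q) (r + b - p) y)"
    by (simp only: s_def)
qed

text \<open>The factor \<open>x powr (r - a)\<close> of \<open>H_density\<close> turns
  \<open>x powr (a - 1)\<close> into \<open>x powr (r - 1)\<close>, and its exponent
  \<open>c + d\<close> equals \<open>r + b - q\<close>. After exchanging the two integrals, the one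
  over \<open>x\<close> is therefore that of \<open>nn_integral_BH_kernel_binomial\<close>.\<close>

theorem distr_BH_beta2_H:
  assumes s: "(a, b, p, q, r) \<in> BH_params" and d: "r - a > 0" and c: "a + b - q > 0"
  shows "distr (BH (a, b, p, q, r) \<Otimes>\<^sub>M beta2 (a + b - q) (r - a)) borel (\<lambda>(x, w). H w x)
    = BH (r - a, a + b - q, b, r + b - p - q, r + b - p)"
proof -
  let ?s = "(a, b, p, q, r)" and ?s' = "(r - a, a + b - q, b, r + b - p - q, r + b - p)"
  let ?c = "a + b - q" and ?d = "r - a"
  let ?B = "beta2 ?c ?d"
  have ab: "a > 0" "b > 0" and pq: "r + b - p - q > 0"
    and pos: "\<And>x. 0 < x \<Longrightarrow> x < 1 \<Longrightarrow> hypergeo_2F1 p q r x > 0"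
    using s by (auto simp: BH_params_def)
  have r: "r > 0" and q: "r + b - q > 0"
    using ab d c by linarith+
  interpret X: prob_space "BH ?s" by (rule prob_space_BH[OF s])
  interpret W: prob_space ?B by (rule prob_space_beta2[OF c d])
  interpret XW: pair_prob_space "BH ?s" ?B ..
  define Z where "Z = (\<integral>x. indicator {0<..<1} x * BH_kernel ?s x \<partial>lborel)"
  define I where "I = (\<integral>x. indicator {0<..<1} x * BH_kernel (r, b, p, q, r) x \<partial>lborel)"
  have Z: "Z > 0"
    unfolding Z_def by (intro BH_kernel_integral_pos BH_kernel_pos[OF s] BH_kernel_integrable[OF s])
  note binomial = nn_integral_BH_kernel_binomial[OF r ab(2) pq q pos, folded I_def]
  \<comment> \<open>\<open>I\<close> is independent of \<open>y\<close>; any point of the unit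
    interval, here \<open>1 / 2\<close>, serves to instantiate the fact.\<close>
  have I: "I > 0"
    using binomial(1)[of "1 / 2"] by simp
  have B: "Beta ?c ?d > 0"
    by (rule Beta_pos[OF c d])
  define C where "C = I / (Z * Beta ?c ?d)"
  have C: "C > 0"
    using I Z B by (simp add: C_def)
  have nonneg: "BH_kernel ?s' y \<ge> 0" if "0 < y" "y < 1" for y
    using binomial(3)[OF _ _ that] by simp
  define F where "F x y = ennreal (indicator {0<..<1} x * BH_kernel ?s x / Z)
      * ennreal (indicator {0<..<1} y * H_density ?c ?d x y)" for x y
  \<comment> \<open>Integrating the joint density over \<open>x\<close> yields the new kernel up to
    the constant \<open>C\<close>, which \<open>BH_unique\<close> later absorbs.\<close>
  have inner: "(\<integral>\<^sup>+x. F x y \<partial>lborel) = ennreal (C * (indicator {0<..<1} y * BH_kernel ?s' y))" for y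
  proof (cases "y \<in> {0<..<1}")
    case True
    then have y: "0 < y" "y < 1" by auto
    define D where "D = y powr (?d - 1) * (1 - y) powr (?c - 1) / (Z * Beta ?c ?d)"
    have D: "D \<ge> 0"
      using Z B by (simp add: D_def)
    have "F x y = ennreal D * ennreal (indicator {0<..<1} x * BH_kernel (r, b, p, q, r) x
        / (1 - (1 - x) * y) powr (r + b - q))" for x
    proof (cases "x \<in> {0<..<1}")
      case x: True
      have powr: "x powr (r - 1) = x powr (a - 1) * x powr ?d"
        by (simp flip: powr_add)
      moreover have "?c + ?d = r + b - q"
        by simp
      ultimately have "BH_kernel ?s x / Z * H_density ?c ?d x y
          = D * (BH_kernel (r, b, p, q, r) x / (1 - (1 - x) * y) powr (r + b - q))"
        by (simp only: H_density_def D_def) (simp add: mult_ac)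
      moreover have "BH_kernel ?s x / Z \<ge> 0"
        using BH_kernel_pos[OF s, of x] x Z by (simp add: less_imp_le del: BH_kernel.simps)
      ultimately show ?thesis
        using x True D by (simp add: F_def ennreal_mult'[symmetric] del: BH_kernel.simps)
    qed (simp add: F_def)
    then have "(\<integral>\<^sup>+x. F x y \<partial>lborel) = ennreal D * ennreal (I * hypergeo_2F1 b (r + b - p - q) (r + b - p) y)"
      by (simp add: nn_integral_cmult binomial(4)[OF _ _ y] del: BH_kernel.simps)
    also have "\<dots> = ennreal (C * (indicator {0<..<1} y * BH_kernel ?s' y))"
      using y by (subst ennreal_mult'[OF D, symmetric]) (simp add: C_def D_def mult_ac)
    finally show ?thesis .
  qed (simp add: F_def)
  have [measurable]: "(\<lambda>(x, w). H w x) \<in> borel_measurable (BH ?s \<Otimes>\<^sub>M ?B)"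
    unfolding H_def by measurable
  have [measurable]: "(\<lambda>w. H w x) \<in> borel_measurable borel" for x
    unfolding H_def by measurable
  have F [measurable]: "(\<lambda>(x, y). F x y) \<in> borel_measurable (borel \<Otimes>\<^sub>M borel)"
    unfolding F_def H_density_def by measurable
  have "distr (BH ?s \<Otimes>\<^sub>M ?B) borel (\<lambda>(x, w). H w x)
      = density lborel (\<lambda>y. ennreal (C * (indicator {0<..<1} y * BH_kernel ?s' y)))" (is "?N = ?N'")
  proof (rule measure_eqI)
    fix A assume "A \<in> sets ?N"
    then have A [measurable]: "A \<in> sets borel" by simp
    have "emeasure ?N A = (\<integral>\<^sup>+z. indicator A (case z of (x, w) \<Rightarrow> H w x) \<partial>(BH ?s \<Otimes>\<^sub>M ?B))"
      by (subst nn_integral_indicator[symmetric], simp, subst nn_integral_distr) auto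
    also have "\<dots> = (\<integral>\<^sup>+x. \<integral>\<^sup>+w. indicator A (H w x) \<partial>?B \<partial>BH ?s)"
      by (subst W.nn_integral_fst[symmetric]) auto
    also have "\<dots> = (\<integral>\<^sup>+x. ennreal (indicator {0<..<1} x * BH_kernel ?s x / Z)
        * (\<integral>\<^sup>+w. indicator A (H w x) \<partial>?B) \<partial>lborel)"
    proof -
      have "(\<lambda>x. \<integral>\<^sup>+w. indicator A (H w x) \<partial>?B) \<in> borel_measurable borel"
        by (rule W.borel_measurable_nn_integral) (unfold H_def, measurable)
      then show ?thesis
        unfolding BH_eq Z_def[symmetric] by (subst nn_integral_density) auto
    qed
    also have "\<dots> = (\<integral>\<^sup>+x. \<integral>\<^sup>+y. F x y * indicator A y \<partial>lborel \<partial>lborel)"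
    proof (rule nn_integral_cong)
      fix x :: real
      show "ennreal (indicator {0<..<1} x * BH_kernel ?s x / Z) * (\<integral>\<^sup>+w. indicator A (H w x) \<partial>?B)
          = (\<integral>\<^sup>+y. F x y * indicator A y \<partial>lborel)"
      proof (cases "x \<in> {0<..<1}")
        case True
        have "(\<integral>\<^sup>+w. indicator A (H w x) \<partial>?B) = emeasure (distr ?B borel (\<lambda>w. H w x)) A"
          by (subst nn_integral_indicator[symmetric], simp, subst nn_integral_distr) auto
        also have "\<dots> = (\<integral>\<^sup>+y. ennreal (indicator {0<..<1} y * H_density ?c ?d x y) * indicator A y \<partial>lborel)"
          using True by (subst distr_beta2_H[OF c d], simp, subst emeasure_density) (auto simp: H_density_def)
        finally show ?thesis
          unfolding F_def mult.assoc by (subst nn_integral_cmult) (auto simp: H_density_def)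
      qed (simp add: F_def)
    qed
    also have "\<dots> = (\<integral>\<^sup>+y. \<integral>\<^sup>+x. F x y * indicator A y \<partial>lborel \<partial>lborel)"
      by (rule lborel_pair.Fubini') measurable
    also have "\<dots> = (\<integral>\<^sup>+y. ennreal (C * (indicator {0<..<1} y * BH_kernel ?s' y)) * indicator A y \<partial>lborel)"
      by (subst nn_integral_multc) (simp_all add: inner del: BH_kernel.simps)
    also have "\<dots> = emeasure ?N' A"
      by (subst emeasure_density) auto
    finally show "emeasure ?N A = emeasure ?N' A" .
  qed simp
  moreover have "prob_space ?N"
    by (rule XW.prob_space_distr) measurable
  ultimately show ?thesis
    using BH_unique[OF _ C nonneg] by metis
qed

section \<open>Edges of the graphs\<close>

lemma BH_commute: "BH (a, b, p, q, r) = BH (a, b, q, p, r)"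
  by (intro BH_cong) (simp add: hypergeo_2F1_commute)

lemma BH_Euler:
  assumes "r \<notin> \<int>\<^sub>\<le>\<^sub>0"
  shows "BH (a, b, p, q, r) = BH (a, b + r - p - q, r - p, r - q, r)"
proof (rule BH_cong)
  fix x :: real assume x: "0 < x" "x < 1"
  have "(1 - x) powr (b + r - p - q - 1) = (1 - x) powr (b - 1) * (1 - x) powr (r - p - q)"
    by (simp flip: powr_add add: algebra_simps)
  then show "BH_kernel (a, b, p, q, r) x = BH_kernel (a, b + r - p - q, r - p, r - q, r) x"
    using x by (simp add: hypergeo_2F1_Euler[OF assms, of x p q])
qed

lemma BH_params_commute: "(a, b, p, q, r) \<in> BH_params \<longleftrightarrow> (a, b, q, p, r) \<in> BH_params"
  by (auto simp: BH_params_def hypergeo_2F1_commute[of p q])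

lemma add_mset_pair_eq_iff:
  "{#a, b#} = {#c, d#} \<longleftrightarrow> (a = c \<and> b = d) \<or> (a = d \<and> b = c)"
  by (auto simp: add_eq_conv_ex)

lemma BH_theta_swap_45: "BH_theta (t1, t2, t3, t4, t5) = BH_theta (t1, t2, t3, t5, t4)"
  by (simp add: BH_theta_def BH_commute[of _ _ "t3 + t5"] add_ac)

text \<open>In these coordinates \<open>r - p = t2 + t4\<close>, \<open>r - q = t2 + t5\<close> and
  \<open>b + r - p - q = t1 + t2\<close>, so Euler's transformation exchanges \<open>t2\<close> and
  \<open>t3\<close>, up to the order of the two upper parameters.\<close>

lemma BH_theta_swap_23:
  assumes "t2 + t3 + t4 + t5 \<notin> \<int>\<^sub>\<le>\<^sub>0"
  shows "BH_theta (t1, t2, t3, t4, t5) = BH_theta (t1, t3, t2, t4, t5)"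
proof -
  have "BH_theta (t1, t2, t3, t4, t5) = BH (t4 + t5, t1 + t2, t2 + t4, t2 + t5, t2 + t3 + t4 + t5)"
    unfolding BH_theta_def params_of_theta.simps by (subst BH_Euler[OF assms]) (simp add: algebra_simps)
  then show ?thesis
    by (simp add: BH_theta_def BH_commute[of _ _ "t2 + t4"] add_ac)
qed

lemma BH_theta_eq:
  assumes "vertex_of s = vertex_of (t1, t2, t3, t4, t5)" "t2 + t3 + t4 + t5 \<notin> \<int>\<^sub>\<le>\<^sub>0"
  shows "BH_theta s = BH_theta (t1, t2, t3, t4, t5)"
proof -
  obtain s1 s2 s3 s4 s5 where s: "s = (s1, s2, s3, s4, s5)" by (cases s)
  have "s1 = t1" "s2 = t2 \<and> s3 = t3 \<or> s2 = t3 \<and> s3 = t2" "s4 = t4 \<and> s5 = t5 \<or> s4 = t5 \<and> s5 = t4"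
    using assms(1) by (auto simp: s add_mset_pair_eq_iff)
  moreover have "t3 + t2 + t4 + t5 \<notin> \<int>\<^sub>\<le>\<^sub>0" "t3 + t2 + t5 + t4 \<notin> \<int>\<^sub>\<le>\<^sub>0"
    using assms(2) by (simp_all add: add_ac)
  ultimately show ?thesis
    unfolding s using BH_theta_swap_45 BH_theta_swap_23 by metis
qed

lemma vertex_of_rep: "vertex_of (vertex_rep (vertex_of t)) = vertex_of t"
  unfolding vertex_rep_def by (rule someI) (rule refl)

text \<open>This is \<open>distr_BH_beta2_H\<close> in the \<theta>-coordinates: there
  \<open>a + b - q = t1 + t5\<close> and \<open>r - a = t2 + t3\<close>, and the image parameters
  are those of the rearranged tuple.\<close>

lemma distr_BH_theta_beta2_H:
  assumes "params_of_theta (t1, t2, t3, t4, t5) \<in> BH_params" "t2 + t3 > 0" "t1 + t5 > 0"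
  shows "distr (BH_theta (t1, t2, t3, t4, t5) \<Otimes>\<^sub>M beta2 (t1 + t5) (t2 + t3)) borel (\<lambda>(x, w). H w x)
    = BH_theta (t5, t4, t1, t2, t3)"
proof -
  have "t4 + t5 + (t1 + t3) - (t3 + t4) = t1 + t5" "t2 + t3 + t4 + t5 - (t4 + t5) = t2 + t3"
    "t2 + t3 + t4 + t5 + (t1 + t3) - (t3 + t5) - (t3 + t4) = t1 + t2"
    "t2 + t3 + t4 + t5 + (t1 + t3) - (t3 + t5) = t4 + t1 + t2 + t3"
    by simp_all
  then show ?thesis
    using distr_BH_beta2_H[of "t4 + t5" "t1 + t3" "t3 + t5" "t3 + t4" "t2 + t3 + t4 + t5"] assms
    by (simp only: BH_theta_def params_of_theta.simps add.commute[of t5 t1])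
qed

text \<open>This reconciles the chosen representative of \<open>v\<close> with the entries naming
  the edge. Exchanging \<open>t4\<close> and \<open>t5\<close> merges the two kinds of edge into
  one, in which \<open>t5\<close> moves to the front.\<close>

lemma acceptable_rep:
  assumes "acceptable v v'"
  obtains t1 t2 t3 t4 t5 where
    "vertex_rep v = (t1, t2, t3, t4, t5) \<or> vertex_rep v = (t1, t2, t3, t5, t4)"
    "v' = (t5, {#t1, t4#}, {#t2, t3#})" "t2 + t3 > 0" "t1 + t5 > 0"
    "beta_edge v v' = beta2 (t1 + t5) (t2 + t3)"
proof -
  obtain s1 s2 s3 s4 s5 where s: "vertex_rep v = (s1, s2, s3, s4, s5)" by (cases "vertex_rep v")
  obtain t1 t2 t3 t4 t5 where v: "v = (t1, {#t2, t3#}, {#t4, t5#})"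
    and v': "v' = (t5, {#t1, t4#}, {#t2, t3#})" and pos: "t2 + t3 > 0" "t1 + t5 > 0"
  proof -
    obtain u1 u2 u3 u4 u5 where u: "v = (u1, {#u2, u3#}, {#u4, u5#})"
      "v' = (u5, {#u1, u4#}, {#u2, u3#}) \<and> u2 + u3 > 0 \<and> u1 + u5 > 0
        \<or> v' = (u4, {#u1, u5#}, {#u2, u3#}) \<and> u2 + u3 > 0 \<and> u1 + u4 > 0"
      using assms unfolding acceptable_def by blast
    then show thesis
      using that[of u1 u2 u3 u4 u5] that[of u1 u2 u3 u5 u4] by (auto simp: add_mset_commute)
  qed
  have "vertex_of (s1, s2, s3, s4, s5) = v"
    using vertex_of_rep[of "(t1, t2, t3, t4, t5)"] s v by (metis vertex_of.simps)
  then have st: "s1 = t1" "{#s2, s3#} = {#t2, t3#}" "s4 = t4 \<and> s5 = t5 \<or> s4 = t5 \<and> s5 = t4"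
    by (auto simp: v add_mset_pair_eq_iff)
  have sum: "s2 + s3 = t2 + t3"
    using st(2) by (auto simp: add_mset_pair_eq_iff)
  show thesis
  \<comment> \<open>The middle pair is ordered as in the representative, the last pair as dictated
    by the edge.\<close>
  proof (rule that[of t1 s2 s3 t4 t5])
    show "beta_edge v v' = beta2 (t1 + t5) (s2 + s3)"
      by (simp add: beta_edge_def v v' sum)
  qed (use st v' pos sum in \<open>auto simp: s\<close>)
qed

lemma prob_space_BH_vertex: "BH_vertex_exists v \<Longrightarrow> prob_space (BH_vertex v)"
  unfolding BH_vertex_exists_def BH_vertex_def BH_theta_exists_def BH_theta_def by (rule prob_space_BH)

lemma sets_BH_vertex [simp, measurable_cong]: "sets (BH_vertex v) = sets borel"
  by (simp add: BH_vertex_def BH_theta_def)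

lemma AE_BH: "AE x in BH s. 0 < x \<and> x < 1"
proof -
  have "AE x in lborel. 0 < indicator {0<..<1} x * BH_kernel s x / Z \<longrightarrow> 0 < x \<and> x < (1::real)" for Z
    by (intro AE_I2) (auto simp: indicator_def simp del: BH_kernel.simps)
  then show ?thesis
    unfolding BH_eq by (subst AE_density) auto
qed

lemma AE_BH_vertex: "AE x in BH_vertex v. 0 < x \<and> x < 1"
  unfolding BH_vertex_def BH_theta_def by (rule AE_BH)

lemma AE_beta2: "AE w in beta2 c d. 0 < w"
  unfolding beta2_def by (subst AE_density) (auto simp: indicator_def)

lemma G_star_star_edge:
  assumes "(v, v') \<in> parcs (G_star_star \<theta>)"
  shows "BH_vertex_exists v" "BH_vertex_exists v'" "acceptable v v'"
  using assms by (auto simp: G_star_star_def G_star_def)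

lemma distr_BH_vertex_beta_edge_H:
  assumes "acceptable v v'" "BH_vertex_exists v" "BH_vertex_exists v'"
  shows "distr (BH_vertex v \<Otimes>\<^sub>M beta_edge v v') borel (\<lambda>(x, w). H w x) = BH_vertex v'"
proof -
  obtain t1 t2 t3 t4 t5 where
    rep: "vertex_rep v = (t1, t2, t3, t4, t5) \<or> vertex_rep v = (t1, t2, t3, t5, t4)"
    and v': "v' = (t5, {#t1, t4#}, {#t2, t3#})" and pos: "t2 + t3 > 0" "t1 + t5 > 0"
    and beta: "beta_edge v v' = beta2 (t1 + t5) (t2 + t3)"
    using acceptable_rep[OF assms(1)] .
  have params: "params_of_theta (t1, t2, t3, t4, t5) \<in> BH_params"
    using rep assms(2) BH_params_commute[of "t4 + t5" "t1 + t3" "t3 + t5"]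
    by (auto simp: BH_vertex_exists_def BH_theta_exists_def add_ac)
  have "BH_vertex v = BH_theta (t1, t2, t3, t4, t5)"
    using rep BH_theta_swap_45[of t1 t2 t3 t4 t5] by (auto simp: BH_vertex_def)
  then have "distr (BH_vertex v \<Otimes>\<^sub>M beta_edge v v') borel (\<lambda>(x, w). H w x) = BH_theta (t5, t4, t1, t2, t3)"
    using distr_BH_theta_beta2_H[OF params pos] by (simp add: beta)
  also have "\<dots> = BH_vertex v'"
  proof -
    obtain s1 s2 s3 s4 s5 where s: "vertex_rep v' = (s1, s2, s3, s4, s5)" by (cases "vertex_rep v'")
    have v'_eq: "v' = vertex_of (t5, t4, t1, t2, t3)"
      by (simp add: v')
    have st: "vertex_of (s1, s2, s3, s4, s5) = vertex_of (t5, t4, t1, t2, t3)"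
      using vertex_of_rep[of "(t5, t4, t1, t2, t3)"] unfolding v'_eq[symmetric] s .
    then have "{#s2, s3#} = {#t4, t1#}" "{#s4, s5#} = {#t2, t3#}" by auto
    then have "s2 + s3 + s4 + s5 = t4 + t1 + t2 + t3"
      unfolding add_mset_pair_eq_iff by auto
    \<comment> \<open>Existence at the target keeps the lower parameter away from the nonpositive
      integers, which changing the representative by Euler's transformation requires.\<close>
    moreover have "s2 + s3 + s4 + s5 \<notin> \<int>\<^sub>\<le>\<^sub>0"
      using assms(3) by (simp add: BH_vertex_exists_def BH_theta_exists_def s BH_params_def)
    ultimately show ?thesis
      using BH_theta_eq[OF st] by (simp add: BH_vertex_def s)
  qed
  finally show ?thesis .
qed

text \<open>Only finitely many laws can then occur along a path, which provides one tail bound for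
  all of them. Every edge is described by five entries of \<theta>, so the image of a finite product
  covers the edges.\<close>

lemma finite_edges: "finite (parcs (G_star_star \<theta>))"
proof -
  define E where "E = set_mset (entries \<theta>)"
  have "finite E" by (simp add: E_def)
  have "parcs (G_star_star \<theta>) \<subseteq>
      (\<lambda>(t1, t2, t3, t4, t5). (vertex_of (t1, t2, t3, t4, t5), vertex_of (t5, t1, t4, t2, t3)))
        ` (E \<times> E \<times> E \<times> E \<times> E)"
  proof
    fix e assume "e \<in> parcs (G_star_star \<theta>)"
    then obtain t1 t2 t3 t4 t5 where t: "entries (t1, t2, t3, t4, t5) = entries \<theta>"
      and e: "fst e = (t1, {#t2, t3#}, {#t4, t5#})"
        "snd e = (t5, {#t1, t4#}, {#t2, t3#}) \<or> snd e = (t4, {#t1, t5#}, {#t2, t3#})"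
      by (auto simp: G_star_star_def G_star_def G_def simp del: entries.simps)
    have t_in: "{t1, t2, t3, t4, t5} \<subseteq> E"
      unfolding E_def t[symmetric] by auto
    from e(2) show "e \<in> (\<lambda>(t1, t2, t3, t4, t5). (vertex_of (t1, t2, t3, t4, t5), vertex_of (t5, t1, t4, t2, t3)))
        ` (E \<times> E \<times> E \<times> E \<times> E)"
    proof
      assume "snd e = (t5, {#t1, t4#}, {#t2, t3#})"
      then show ?thesis using e(1) t_in
        by (intro image_eqI[of _ _ "(t1, t2, t3, t4, t5)"]) (auto simp: prod_eq_iff)
    next
      assume "snd e = (t4, {#t1, t5#}, {#t2, t3#})"
      then show ?thesis using e(1) t_in
        by (intro image_eqI[of _ _ "(t1, t2, t3, t5, t4)"]) (auto simp: prod_eq_iff add_mset_commute)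
    qed
  qed
  then show ?thesis
    by (rule finite_subset) (intro finite_imageI finite_cartesian_product \<open>finite E\<close>)
qed

section \<open>Convergence of the continued fraction\<close>

lemma H_pos: "w > 0 \<Longrightarrow> x \<ge> 0 \<Longrightarrow> 0 < H w x"
  by (simp add: H_def add_pos_nonneg)

lemma H_le_1: "w > 0 \<Longrightarrow> x \<ge> 0 \<Longrightarrow> H w x \<le> 1"
  by (simp add: H_def divide_simps add_pos_nonneg)

lemma H_antimono: "w > 0 \<Longrightarrow> 0 \<le> x \<Longrightarrow> x \<le> y \<Longrightarrow> H w y \<le> H w x"
  by (auto simp: H_def intro!: divide_left_mono mult_pos_pos add_pos_nonneg)

lemma comp_H_cong: "(\<And>j. j \<in> {1..n} \<Longrightarrow> w j = w' j) \<Longrightarrow> comp_H w n = comp_H w' n"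
  by (induction n) auto

text \<open>The induction changes the innermost value from \<open>y\<close> to
  \<open>w (Suc n) / (1 + y)\<close>, hence the general \<open>y\<close>; the convergent is the case
  \<open>y = 0\<close>.\<close>

lemma comp_H_1: "comp_H w n (1 / (1 + y)) = 1 / (1 + foldr (\<lambda>j y. w j / (1 + y)) [1..<Suc n] y)"
proof (induction n arbitrary: y)
  case (Suc n)
  have "comp_H w (Suc n) (1 / (1 + y)) = comp_H w n (1 / (1 + w (Suc n) / (1 + y)))"
    by (simp add: H_def)
  also have "\<dots> = 1 / (1 + foldr (\<lambda>j y. w j / (1 + y)) [1..<Suc n] (w (Suc n) / (1 + y)))"
    by (rule Suc)
  finally show ?case by simp
qed simp

lemma cfrac_convergent_eq: "cfrac_convergent w n = comp_H w n 1"
  using comp_H_1[of w n 0] by (simp add: cfrac_convergent_def)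

text \<open>Each map reverses order, so the order of the endpoints alternates with \<open>n\<close>;
  the symmetric \<open>closed_segment\<close> avoids tracking it.\<close>

lemma comp_H_in_segment:
  assumes "\<And>j. j \<ge> 1 \<Longrightarrow> w j > 0" "0 \<le> a" "a \<le> u" "u \<le> b"
  shows "comp_H w n u \<in> closed_segment (comp_H w n a) (comp_H w n b)"
  using assms(2-)
proof (induction n arbitrary: a u b)
  case 0
  then show ?case by (simp add: closed_segment_eq_real_ivl)
next
  case (Suc n)
  have w: "w (Suc n) > 0" using assms(1) by simp
  have "0 \<le> H (w (Suc n)) b" "H (w (Suc n)) b \<le> H (w (Suc n)) u" "H (w (Suc n)) u \<le> H (w (Suc n)) a"
    using Suc.prems w by (auto intro!: H_antimono less_imp_le[OF H_pos])
  from Suc.IH[OF this] show ?case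
    by (simp add: closed_segment_commute)
qed

text \<open>Every map sends the unit interval into itself, so the maps after the \<open>n\<close>-th
  can be absorbed into the argument. This is the nesting of the image intervals.\<close>

lemma comp_H_split:
  assumes "\<And>j. j \<ge> 1 \<Longrightarrow> w j > 0" "n \<le> m" "x \<in> {0..1}"
  shows "\<exists>u\<in>{0..1}. comp_H w m x = comp_H w n u"
  using assms(2,3)
proof (induction m arbitrary: x rule: dec_induct)
  case (step m)
  have "H (w (Suc m)) x \<in> {0..1}"
    using step.prems assms(1)[of "Suc m"] by (auto intro!: H_le_1 less_imp_le[OF H_pos])
  from step.IH[OF this] show ?case by simp
qed auto

definition comp_H_width :: "(nat \<Rightarrow> real) \<Rightarrow> nat \<Rightarrow> real" where
  "comp_H_width w n = \<bar>comp_H w n 0 - comp_H w n 1\<bar>"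

lemma comp_H_dist_le_width:
  assumes w: "\<And>j. j \<ge> 1 \<Longrightarrow> w j > 0" and "x \<in> {0..1}" "y \<in> {0..1}" "n \<le> m" "n \<le> k"
  shows "\<bar>comp_H w m x - comp_H w k y\<bar> \<le> comp_H_width w n"
proof -
  obtain u v where u: "u \<in> {0..1}" "comp_H w m x = comp_H w n u" and v: "v \<in> {0..1}" "comp_H w k y = comp_H w n v"
    using comp_H_split[of w n m x, OF w] comp_H_split[of w n k y, OF w] assms by metis
  have "comp_H w n u \<in> closed_segment (comp_H w n 0) (comp_H w n 1)"
    "comp_H w n v \<in> closed_segment (comp_H w n 0) (comp_H w n 1)"
    using u v by (auto intro!: comp_H_in_segment w)
  then show ?thesis
    unfolding u v comp_H_width_def by (auto simp: closed_segment_eq_real_ivl split: if_splits)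
qed

lemma comp_H_width_bounds:
  assumes w: "\<And>j. j \<ge> 1 \<Longrightarrow> w j > 0"
  shows "0 \<le> comp_H_width w n" "comp_H_width w n \<le> 1"
proof -
  have "comp_H_width w n \<le> comp_H_width w 0"
    unfolding comp_H_width_def[of w n] by (intro comp_H_dist_le_width w) auto
  then show "comp_H_width w n \<le> 1" by (simp add: comp_H_width_def)
qed (simp add: comp_H_width_def)

text \<open>The quantity \<open>max x y / min x y - 1\<close>, which the maps \<^const>\<open>H\<close> contract.\<close>

definition ratio_gap :: "real \<Rightarrow> real \<Rightarrow> real" where
  "ratio_gap x y = \<bar>x - y\<bar> / min x y"

lemma ratio_gap_commute: "ratio_gap x y = ratio_gap y x"
  by (simp add: ratio_gap_def min.commute abs_minus_commute)

text \<open>For \<open>x \<le> y\<close> the quotient of the images exceeds 1 by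
  \<open>w * x / (1 + w * x)\<close> times \<open>(y - x) / x\<close>. The first factor increases
  with \<open>x\<close>, and \<open>x \<le> 1\<close>.\<close>

lemma ratio_gap_H:
  assumes w: "w > 0" and x: "0 < x" "x \<le> 1" and y: "0 < y" "y \<le> 1"
  shows "ratio_gap (H w x) (H w y) \<le> w / (1 + w) * ratio_gap x y"
proof -
  have *: "ratio_gap (H w x) (H w y) \<le> w / (1 + w) * ratio_gap x y" if "0 < x" "x \<le> y" "y \<le> 1" for x y
  proof -
    have pos: "1 + w * x > 0" "1 + w * y > 0" using w that by (auto intro!: add_pos_pos)
    have "H w y \<le> H w x" using w that by (intro H_antimono) auto
    then have "ratio_gap (H w x) (H w y) = H w x / H w y - 1"
      using H_pos[OF w, of y] that by (simp add: ratio_gap_def min_def diff_divide_distrib)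
    also have "\<dots> = w * x / (1 + w * x) * ((y - x) / x)"
      using pos that by (simp add: H_def divide_simps) (simp add: algebra_simps)
    also have "\<dots> \<le> w / (1 + w) * ((y - x) / x)"
    proof (rule mult_right_mono)
      show "w * x / (1 + w * x) \<le> w / (1 + w)"
        using w that by (simp add: divide_simps add_pos_pos) (simp add: algebra_simps)
    qed (use that in auto)
    also have "(y - x) / x = ratio_gap x y"
      using that by (simp add: ratio_gap_def min_def)
    finally show ?thesis .
  qed
  show ?thesis
    using *[of x y] *[of y x] x y ratio_gap_commute by (cases "x \<le> y") auto
qed

lemma comp_H_dist_le_ratio_gap:
  assumes w: "\<And>j. j \<ge> 1 \<Longrightarrow> w j > 0" and x: "0 < x" "x \<le> 1" and y: "0 < y" "y \<le> 1"
  shows "\<bar>comp_H w n x - comp_H w n y\<bar> \<le> (\<Prod>j\<in>{1..n}. w j / (1 + w j)) * ratio_gap x y"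
  using x y
proof (induction n arbitrary: x y)
  case 0
  then have "\<bar>x - y\<bar> * min x y \<le> \<bar>x - y\<bar> * 1" by (intro mult_left_mono) auto
  with 0 show ?case by (simp add: ratio_gap_def divide_simps)
next
  case (Suc n)
  let ?w = "w (Suc n)"
  have w': "?w > 0" using w by simp
  have "\<bar>comp_H w (Suc n) x - comp_H w (Suc n) y\<bar>
      \<le> (\<Prod>j\<in>{1..n}. w j / (1 + w j)) * ratio_gap (H ?w x) (H ?w y)"
    using Suc.IH[of "H ?w x" "H ?w y"] Suc.prems H_pos[OF w'] H_le_1[OF w'] by simp
  also have "\<dots> \<le> (\<Prod>j\<in>{1..n}. w j / (1 + w j)) * (?w / (1 + ?w) * ratio_gap x y)"
    using Suc.prems w w' by (intro mult_left_mono ratio_gap_H prod_nonneg) (auto intro!: divide_nonneg_pos add_pos_pos less_imp_le[OF w])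
  finally show ?case
    by (simp add: mult_ac)
qed

text \<open>The contraction bound needs positive points, so the innermost map is applied first: it
  sends 0 and 1 to 1 and \<open>1 / (1 + w (Suc n))\<close>, whose ratio gap is
  \<open>w (Suc n)\<close>.\<close>

lemma comp_H_width_Suc_le:
  assumes w: "\<And>j. j \<ge> 1 \<Longrightarrow> w j > 0"
  shows "comp_H_width w (Suc n) \<le> (\<Prod>j\<in>{1..n}. w j / (1 + w j)) * w (Suc n)"
proof -
  have w': "w (Suc n) > 0" using w by simp
  then have "ratio_gap (H (w (Suc n)) 0) (H (w (Suc n)) 1) = w (Suc n)"
    by (simp add: ratio_gap_def H_def min_def divide_simps)
  then show ?thesis
    using comp_H_dist_le_ratio_gap[of w "H (w (Suc n)) 0" "H (w (Suc n)) 1" n, OF w] w'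
    by (simp add: comp_H_width_def H_pos H_le_1)
qed

text \<open>No factor of the product \<open>P\<close> exceeds 1, and each of the infinitely many
  indices with \<open>w j \<le> C\<close> contributes at most \<open>C / (1 + C)\<close>.\<close>

lemma comp_H_width_tendsto_0:
  assumes w: "\<And>j. j \<ge> 1 \<Longrightarrow> w j > 0" and io: "\<And>m. \<exists>j\<ge>m. w j \<le> C" and C: "C > 0"
  shows "comp_H_width w \<longlonglongrightarrow> 0"
proof (rule LIMSEQ_I)
  fix e :: real assume e: "e > 0"
  define P where "P n = (\<Prod>j\<in>{1..n}. w j / (1 + w j))" for n
  have factor: "0 \<le> w j / (1 + w j)" "w j / (1 + w j) \<le> 1" if "j \<ge> 1" for j
    using w[OF that] by (auto simp: divide_simps)
  have P_nonneg: "P n \<ge> 0" for n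
    unfolding P_def using factor by (intro prod_nonneg) auto
  have P_antimono: "P n \<le> P m" if "m \<le> n" for m n
    using that
  proof (induction n rule: dec_induct)
    case (step n)
    have "P (Suc n) = P n * (w (Suc n) / (1 + w (Suc n)))" by (simp add: P_def)
    also have "\<dots> \<le> P n * 1" using factor[of "Suc n"] P_nonneg[of n] by (intro mult_left_mono) auto
    finally show ?case using step.IH by simp
  qed simp
  have small: "\<exists>n. P n \<le> (C / (1 + C)) ^ m" for m
  proof (induction m)
    case 0
    show ?case by (rule exI[of _ 0]) (simp add: P_def)
  next
    case (Suc m)
    then obtain n where n: "P n \<le> (C / (1 + C)) ^ m" by blast
    obtain j where "j \<ge> Suc n" "w j \<le> C" using io by blast
    then obtain k where j: "n \<le> k" "w (Suc k) \<le> C" by (cases j) auto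
    have "P (Suc k) = P k * (w (Suc k) / (1 + w (Suc k)))" by (simp add: P_def)
    also have "\<dots> \<le> (C / (1 + C)) ^ m * (C / (1 + C))"
    proof (rule mult_mono)
      show "P k \<le> (C / (1 + C)) ^ m" using P_antimono[OF j(1)] n by simp
      show "w (Suc k) / (1 + w (Suc k)) \<le> C / (1 + C)"
        using j(2) w[of "Suc k"] C by (simp add: divide_simps) (simp add: algebra_simps)
    qed (use C factor[of "Suc k"] in auto)
    finally show ?case by (metis power_Suc2)
  qed
  have "(\<lambda>m. C * (C / (1 + C)) ^ m) \<longlonglongrightarrow> C * 0"
    using C by (intro tendsto_intros LIMSEQ_realpow_zero) auto
  then have "\<forall>\<^sub>F m in sequentially. C * (C / (1 + C)) ^ m < e"
    using e by (intro order_tendstoD(2)) auto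
  then obtain m where m: "C * (C / (1 + C)) ^ m < e"
    by (auto simp: eventually_sequentially)
  obtain n where n: "P n \<le> (C / (1 + C)) ^ m" using small by blast
  \<comment> \<open>One more small index is used, so that the unpaired factor
    \<open>w (Suc k)\<close> in the width bound is also at most \<open>C\<close>.\<close>
  obtain j where "j \<ge> Suc n" "w j \<le> C" using io by blast
  then obtain k where j: "n \<le> k" "w (Suc k) \<le> C" by (cases j) auto
  have "comp_H_width w (Suc k) \<le> P k * w (Suc k)"
    unfolding P_def by (rule comp_H_width_Suc_le[OF w])
  also have "\<dots> \<le> (C / (1 + C)) ^ m * C"
    using P_antimono[OF j(1)] n j(2) P_nonneg[of k] w[of "Suc k"] C by (intro mult_mono) auto
  finally have k: "comp_H_width w (Suc k) < e" using m by (simp add: mult.commute)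
  have "comp_H_width w i < e" if "i \<ge> Suc k" for i
  proof -
    have "comp_H_width w i \<le> comp_H_width w (Suc k)"
      unfolding comp_H_width_def[of w i] using that by (intro comp_H_dist_le_width w) auto
    with k show ?thesis by simp
  qed
  then show "\<exists>no. \<forall>n\<ge>no. norm (comp_H_width w n - 0) < e"
    using comp_H_width_bounds(1)[OF w] by (intro exI[of _ "Suc k"]) auto
qed

lemma comp_H_converges:
  assumes w: "\<And>j. j \<ge> 1 \<Longrightarrow> w j > 0" and width: "comp_H_width w \<longlonglongrightarrow> 0"
  defines "Z \<equiv> lim (\<lambda>n. comp_H w n 1)"
  shows "x > 0 \<Longrightarrow> (\<lambda>n. comp_H w n x) \<longlonglongrightarrow> Z"
    and "0 \<le> x \<Longrightarrow> x \<le> 1 \<Longrightarrow> \<bar>comp_H w n x - Z\<bar> \<le> comp_H_width w n"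
proof -
  have "Cauchy (\<lambda>n. comp_H w n 1)"
  proof (rule CauchyI)
    fix e :: real assume "e > 0"
    then obtain N where "comp_H_width w N < e"
      using order_tendstoD(2)[OF width] by (auto simp: eventually_sequentially)
    then show "\<exists>N. \<forall>m\<ge>N. \<forall>n\<ge>N. norm (comp_H w m 1 - comp_H w n 1) < e"
      using comp_H_dist_le_width[of w 1 1 N, OF w] by (intro exI[of _ N]) fastforce
  qed
  then have lim: "(\<lambda>n. comp_H w n 1) \<longlonglongrightarrow> Z"
    unfolding Z_def by (simp add: Cauchy_convergent convergent_LIMSEQ_iff[symmetric])
  have dist: "\<bar>comp_H w n x - Z\<bar> \<le> comp_H_width w n" if "0 \<le> x" "x \<le> 1" for n x
  proof (rule LIMSEQ_le_const2)
    show "(\<lambda>m. \<bar>comp_H w n x - comp_H w m 1\<bar>) \<longlonglongrightarrow> \<bar>comp_H w n x - Z\<bar>"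
      by (intro tendsto_intros lim)
    show "\<exists>N. \<forall>m\<ge>N. \<bar>comp_H w n x - comp_H w m 1\<bar> \<le> comp_H_width w n"
      using that by (intro exI[of _ n] allI impI comp_H_dist_le_width w) auto
  qed
  then show "0 \<le> x \<Longrightarrow> x \<le> 1 \<Longrightarrow> \<bar>comp_H w n x - Z\<bar> \<le> comp_H_width w n" .
  show "(\<lambda>n. comp_H w n x) \<longlonglongrightarrow> Z" if x: "x > 0"
  proof -
    \<comment> \<open>A point \<open>x > 1\<close> lies outside the nested intervals, but the
      innermost map brings it into the unit interval; hence the shift of the index by one.\<close>
    have "(\<lambda>n. comp_H w (Suc n) x - Z) \<longlonglongrightarrow> 0"
    proof (rule Lim_null_comparison[OF _ width], intro always_eventually allI)
      fix n
      show "norm (comp_H w (Suc n) x - Z) \<le> comp_H_width w n"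
        using dist[of "H (w (Suc n)) x" n] w[of "Suc n"] x by (simp add: H_le_1 less_imp_le[OF H_pos])
    qed
    then have "(\<lambda>n. comp_H w (Suc n) x) \<longlonglongrightarrow> Z"
      by (rule LIM_zero_cancel)
    then show ?thesis
      by (rule LIMSEQ_imp_Suc)
  qed
qed

section \<open>The law of the limit\<close>

lemma borel_measurable_comp_H [measurable (raw)]:
  assumes "\<And>j. j \<in> {1..n} \<Longrightarrow> W j \<in> borel_measurable M" and "u \<in> borel_measurable M"
  shows "(\<lambda>z. comp_H (\<lambda>j. W j z) n (u z)) \<in> borel_measurable M"
  using assms
proof (induction n arbitrary: u)
  case (Suc n)
  have "W (Suc n) \<in> borel_measurable M" using Suc.prems by simp
  then have "(\<lambda>z. H (W (Suc n) z) (u z)) \<in> borel_measurable M"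
    unfolding H_def using Suc.prems(2) by measurable
  from Suc.IH[OF _ this] Suc.prems(1) show ?case by simp
qed simp

text \<open>By independence, any \<open>k\<close> of the variables all exceed \<open>C\<close> with
  probability at most \<open>(1 / 2) ^ k\<close>, so almost surely no whole tail of the sequence
  does.\<close>

lemma (in prob_space) AE_infinitely_often_le:
  fixes W :: "nat \<Rightarrow> 'a \<Rightarrow> real"
  assumes indep: "indep_vars (\<lambda>_. borel) W {1..}"
    and le: "\<And>n. n \<ge> 1 \<Longrightarrow> prob {\<omega> \<in> space M. W n \<omega> > C} \<le> 1 / 2"
  shows "AE \<omega> in M. \<forall>m. \<exists>j\<ge>m. W j \<omega> \<le> C"
proof (subst AE_all_countable, rule allI)
  fix m :: nat
  have meas: "W j \<in> borel_measurable M" if "j \<ge> 1" for j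
    using indep that by (auto simp: indep_vars_def)
  \<comment> \<open>Starting at \<open>Suc m\<close> keeps all indices at least 1, where
    \<open>W\<close> is measurable and independent.\<close>
  define A where "A = (\<Inter>j\<in>{Suc m..}. W j -` {C<..} \<inter> space M)"
  have A: "A \<in> events"
    unfolding A_def using meas by (intro sets.countable_INT') auto
  have "prob A \<le> (1 / 2) ^ k" for k
  proof (cases "k = 0")
    case False
    let ?J = "{Suc m..<Suc m + k}"
    have "prob A \<le> prob (\<Inter>j\<in>?J. W j -` {C<..} \<inter> space M)"
    proof (rule finite_measure_mono)
      show "(\<Inter>j\<in>?J. W j -` {C<..} \<inter> space M) \<in> events"
        using meas False by (intro sets.finite_INT) auto
    qed (auto simp: A_def)
    also have "\<dots> = (\<Prod>j\<in>?J. prob (W j -` {C<..} \<inter> space M))"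
      using False by (intro indep_varsD[OF indep]) auto
    also have "\<dots> \<le> (\<Prod>j\<in>?J. 1 / 2)"
    proof (intro prod_mono conjI)
      fix j assume "j \<in> ?J"
      then show "prob (W j -` {C<..} \<inter> space M) \<le> 1 / 2"
        using le[of j] by (auto simp: vimage_def Int_def conj_commute)
    qed simp
    finally show ?thesis by simp
  qed simp
  moreover have "(\<lambda>k. (1 / 2 :: real) ^ k) \<longlonglongrightarrow> 0"
    by (intro LIMSEQ_realpow_zero) auto
  ultimately have "prob A \<le> 0"
    by (intro LIMSEQ_le_const) auto
  then have "AE \<omega> in M. \<omega> \<notin> A"
    using prob_eq_0[OF A] measure_nonneg[of M A] by simp
  then show "AE \<omega> in M. \<exists>j\<ge>m. W j \<omega> \<le> C"
    using AE_space
  proof eventually_elim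
    case (elim \<omega>)
    then obtain j where "j \<ge> Suc m" "W j \<omega> \<le> C" by (auto simp: A_def not_less)
    then show ?case by (intro exI[of _ j]) auto
  qed
qed

text \<open>The events \<open>X > i\<close> decrease to the empty set. The bound is given for all
  larger \<open>D\<close> so that finitely many laws can share one threshold.\<close>

lemma (in prob_space) exists_tail_le_half:
  fixes X :: "'a \<Rightarrow> real"
  assumes [measurable]: "X \<in> borel_measurable M"
  shows "\<exists>C. \<forall>D\<ge>C. prob {\<omega> \<in> space M. X \<omega> > D} \<le> 1 / 2"
proof -
  have "(\<lambda>i. prob {\<omega> \<in> space M. X \<omega> > real i}) \<longlonglongrightarrow> prob (\<Inter>i. {\<omega> \<in> space M. X \<omega> > real i})"
    by (intro finite_Lim_measure_decseq) (auto simp: decseq_def)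
  also have "(\<Inter>i. {\<omega> \<in> space M. X \<omega> > real i}) = {}"
    by (auto simp: not_less) (metis less_asym reals_Archimedean2)
  finally have "\<forall>\<^sub>F i in sequentially. prob {\<omega> \<in> space M. X \<omega> > real i} < 1 / 2"
    by (intro order_tendstoD(2)) auto
  then obtain i where i: "prob {\<omega> \<in> space M. X \<omega> > real i} < 1 / 2"
    by (auto simp: eventually_sequentially)
  have "prob {\<omega> \<in> space M. X \<omega> > D} \<le> 1 / 2" if "D \<ge> real i" for D
  proof -
    have "prob {\<omega> \<in> space M. X \<omega> > D} \<le> prob {\<omega> \<in> space M. X \<omega> > real i}"
      using that by (intro finite_measure_mono) auto
    with i show ?thesis by simp
  qed
  then show ?thesis by blast
qed

text \<open>The innermost map of \<open>comp_H w (Suc n)\<close> uses the last coordinate.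
  Integrating that coordinate together with the starting point replaces \<open>\<nu> (Suc n)\<close>
  by \<open>\<nu> n\<close>, and the induction hypothesis handles the remaining maps.\<close>

lemma nn_integral_comp_H_PiM:
  fixes K \<nu> :: "nat \<Rightarrow> real measure"
  assumes K: "\<And>i. prob_space (K i)" "\<And>i. sets (K i) = sets borel"
    and \<nu>: "\<And>n. prob_space (\<nu> n)" "\<And>n. sets (\<nu> n) = sets borel"
    and step: "\<And>n. distr (\<nu> (Suc n) \<Otimes>\<^sub>M K (Suc n)) borel (\<lambda>(x, w). H w x) = \<nu> n"
    and f [measurable]: "f \<in> borel_measurable borel"
  shows "(\<integral>\<^sup>+x. \<integral>\<^sup>+w. f (comp_H w n x) \<partial>PiM {1..n} K \<partial>\<nu> n) = (\<integral>\<^sup>+x. f x \<partial>\<nu> 0)"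
proof (induction n)
  case 0
  show ?case
    by (simp add: PiM_empty nn_integral_count_space_finite)
next
  case (Suc n)
  interpret K: prob_space "K i" for i by (rule K)
  interpret \<nu>: prob_space "\<nu> i" for i by (rule \<nu>)
  interpret PK: product_prob_space K "UNIV :: nat set" ..
  note [measurable_cong] = K(2) \<nu>(2)
  have meas: "(\<lambda>(x, w). f (comp_H w n x)) \<in> borel_measurable (borel \<Otimes>\<^sub>M PiM J K)" if "{1..n} \<subseteq> J" for n J
  proof -
    have [measurable]: "(\<lambda>z. snd z j) \<in> borel_measurable (borel \<Otimes>\<^sub>M PiM J K)" if "j \<in> J" for j
      by (rule measurable_compose[OF measurable_snd measurable_compose[OF measurable_component_singleton]])
        (use that K(2) in auto)
    have "(\<lambda>z. comp_H (\<lambda>j. snd z j) n (fst z)) \<in> borel_measurable (borel \<Otimes>\<^sub>M PiM J K)"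
      using that by (intro borel_measurable_comp_H) auto
    then show ?thesis
      by (simp add: case_prod_beta)
  qed
  define g where "g u = (\<integral>\<^sup>+w. f (comp_H w n u) \<partial>PiM {1..n} K)" for u
  interpret PM: prob_space "PiM {1..n} K" by (rule prob_space_PiM) (rule K)
  have g [measurable]: "g \<in> borel_measurable borel"
    unfolding g_def using meas[of n "{1..n}"] by (intro PM.borel_measurable_nn_integral) auto
  have "(\<integral>\<^sup>+w. f (comp_H w (Suc n) x) \<partial>PiM {1..Suc n} K) = (\<integral>\<^sup>+y. g (H y x) \<partial>K (Suc n))" for x
  proof -
    have "(\<integral>\<^sup>+w. f (comp_H w (Suc n) x) \<partial>PiM (insert (Suc n) {1..n}) K)
        = (\<integral>\<^sup>+y. \<integral>\<^sup>+w. f (comp_H (w(Suc n := y)) (Suc n) x) \<partial>PiM {1..n} K \<partial>K (Suc n))"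
    proof (rule PK.product_nn_integral_insert_rev)
      show "(\<lambda>w. f (comp_H w (Suc n) x)) \<in> borel_measurable (PiM (insert (Suc n) {1..n}) K)"
        using measurable_compose[OF measurable_Pair1'[of x borel] meas[of "Suc n" "insert (Suc n) {1..n}"]]
        by (auto simp: atLeastAtMostSuc_conv)
    qed auto
    also have "\<dots> = (\<integral>\<^sup>+y. g (H y x) \<partial>K (Suc n))"
    proof (intro nn_integral_cong)
      fix y
      have "comp_H (w(Suc n := y)) n = comp_H w n" for w
        by (rule comp_H_cong) auto
      then show "(\<integral>\<^sup>+w. f (comp_H (w(Suc n := y)) (Suc n) x) \<partial>PiM {1..n} K) = g (H y x)"
        by (simp add: g_def)
    qed
    also have "insert (Suc n) {1..n} = {1..Suc n}" by auto
    finally show ?thesis .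
  qed
  then have "(\<integral>\<^sup>+x. \<integral>\<^sup>+w. f (comp_H w (Suc n) x) \<partial>PiM {1..Suc n} K \<partial>\<nu> (Suc n))
      = (\<integral>\<^sup>+x. \<integral>\<^sup>+y. g (H y x) \<partial>K (Suc n) \<partial>\<nu> (Suc n))"
    by simp
  also have "\<dots> = (\<integral>\<^sup>+z. g (case z of (x, y) \<Rightarrow> H y x) \<partial>(\<nu> (Suc n) \<Otimes>\<^sub>M K (Suc n)))"
    by (subst K.nn_integral_fst[symmetric]) (auto simp: H_def)
  also have "\<dots> = (\<integral>\<^sup>+u. g u \<partial>distr (\<nu> (Suc n) \<Otimes>\<^sub>M K (Suc n)) borel (\<lambda>(x, y). H y x))"
    by (subst nn_integral_distr) (auto simp: H_def)
  also have "\<dots> = (\<integral>\<^sup>+x. f x \<partial>\<nu> 0)"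
    unfolding step using Suc by (simp add: g_def)
  finally show ?case .
qed

text \<open>After pulling out a factor of modulus 1, this is the first-order bound for
  \<open>iexp\<close> at \<open>x - y\<close>.\<close>

lemma norm_iexp_diff_le: "norm (iexp x - iexp y) \<le> \<bar>x - y\<bar>"
proof -
  have "iexp x - iexp y = iexp y * (iexp (x - y) - 1)"
    by (simp add: right_diff_distrib exp_add[symmetric] algebra_simps)
  then show ?thesis
    using iexp_approx1[of "x - y" 0] by (simp add: norm_mult)
qed

text \<open>On the product space, \<open>X n\<close> has law \<open>\<nu> 0\<close> and lies within
  \<open>e n\<close> of \<open>Z\<close>. The characteristic functions of \<open>\<nu> 0\<close> and
  \<open>Z\<close> thus differ at \<open>t\<close> by at most \<bar>t\<bar> times the mean of
  \<open>e n\<close>, which tends to 0 by dominated convergence.\<close>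

theorem (in prob_space) distr_backward_limit:
  fixes W :: "nat \<Rightarrow> 'a \<Rightarrow> real" and \<nu> :: "nat \<Rightarrow> real measure"
  assumes indep: "indep_vars (\<lambda>_. borel) W {1..}"
    and \<nu>: "\<And>n. prob_space (\<nu> n)" "\<And>n. sets (\<nu> n) = sets borel" "\<And>n. AE x in \<nu> n. 0 \<le> x \<and> x \<le> 1"
    and step: "\<And>n. distr (\<nu> (Suc n) \<Otimes>\<^sub>M distr M borel (W (Suc n))) borel (\<lambda>(x, w). H w x) = \<nu> n"
    and pos: "AE \<omega> in M. \<forall>j\<ge>1. W j \<omega> > 0"
    and width: "AE \<omega> in M. comp_H_width (\<lambda>j. W j \<omega>) \<longlonglongrightarrow> 0"
  defines "Z \<equiv> \<lambda>\<omega>. lim (\<lambda>n. comp_H (\<lambda>j. W j \<omega>) n 1)"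
  shows "Z \<in> borel_measurable M" "distr M borel Z = \<nu> 0"
proof -
  have W [measurable]: "W j \<in> borel_measurable M" if "j \<ge> 1" for j
    using indep that by (auto simp: indep_vars_def)
  have comp_meas [measurable]: "(\<lambda>\<omega>. comp_H (\<lambda>j. W j \<omega>) n x) \<in> borel_measurable M" for n x
    by (intro borel_measurable_comp_H) auto
  show Z [measurable]: "Z \<in> borel_measurable M"
    unfolding Z_def by measurable
  define e where "e n \<omega> = comp_H_width (\<lambda>j. W j \<omega>) n" for n \<omega>
  have e_meas [measurable]: "e n \<in> borel_measurable M" for n
    unfolding e_def comp_H_width_def by measurable
  have e_bound: "AE \<omega> in M. norm (e n \<omega>) \<le> 1" for n
    using pos by eventually_elim (use comp_H_width_bounds in \<open>auto simp: e_def\<close>)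
  have e_int: "integrable M (e n)" for n
    by (rule integrable_const_bound[OF e_bound]) simp
  have "(\<lambda>n. \<integral>\<omega>. e n \<omega> \<partial>M) \<longlonglongrightarrow> (\<integral>\<omega>. 0 \<partial>M)"
  proof (rule integral_dominated_convergence[where w = "\<lambda>_. 1"])
    show "AE \<omega> in M. (\<lambda>n. e n \<omega>) \<longlonglongrightarrow> 0"
      using width by (simp add: e_def)
  qed (use e_bound in auto)
  then have e_lim: "(\<lambda>n. \<bar>t\<bar> * (\<integral>\<omega>. e n \<omega> \<partial>M)) \<longlonglongrightarrow> 0" for t
    using tendsto_mult_right_zero by fastforce
  interpret \<nu>: prob_space "\<nu> i" for i by (rule \<nu>)
  note [measurable_cong] = \<nu>(2)
  interpret P: pair_prob_space "\<nu> i" M for i ..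
  define X where "X n = (\<lambda>(x, \<omega>). comp_H (\<lambda>j. W j \<omega>) n x)" for n
  have X [measurable]: "X n \<in> borel_measurable (\<nu> n \<Otimes>\<^sub>M M)" for n
    unfolding X_def case_prod_beta
    by (intro borel_measurable_comp_H measurable_compose[OF measurable_snd W]) auto
  have distr_X: "distr (\<nu> n \<Otimes>\<^sub>M M) borel (X n) = \<nu> 0" if n: "n \<ge> 1" for n
  proof (rule measure_eqI)
    fix A assume "A \<in> sets (distr (\<nu> n \<Otimes>\<^sub>M M) borel (X n))"
    then have A [measurable]: "A \<in> sets borel" by simp
    \<comment> \<open>Nothing is assumed about \<open>W 0\<close>; \<open>max 1 i\<close> puts the
      law of \<open>W 1\<close> at index 0, so that every \<open>K i\<close> is a probability
      measure.\<close>
    define K where "K i = distr M borel (W (max 1 i))" for i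
    have K: "prob_space (K i)" for i
      unfolding K_def by (intro prob_space_distr W) simp
    have law: "distr M (\<Pi>\<^sub>M i\<in>{1..n}. borel) (\<lambda>\<omega>. \<lambda>i\<in>{1..n}. W i \<omega>) = PiM {1..n} K"
    proof -
      have "indep_vars (\<lambda>_. borel) W {1..n}"
        by (rule indep_vars_subset[OF indep]) auto
      then have "distr M (\<Pi>\<^sub>M i\<in>{1..n}. borel) (\<lambda>\<omega>. \<lambda>i\<in>{1..n}. W i \<omega>)
          = (\<Pi>\<^sub>M i\<in>{1..n}. distr M borel (W i))"
        using n W by (subst (asm) indep_vars_iff_distr_eq_PiM') auto
      also have "\<dots> = PiM {1..n} K"
        by (intro PiM_cong) (auto simp: K_def max_def)
      finally show ?thesis .
    qed
    have "emeasure (distr (\<nu> n \<Otimes>\<^sub>M M) borel (X n)) A = (\<integral>\<^sup>+z. indicator A (X n z) \<partial>(\<nu> n \<Otimes>\<^sub>M M))"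
      by (subst nn_integral_indicator[symmetric], simp, subst nn_integral_distr) auto
    also have "\<dots> = (\<integral>\<^sup>+x. \<integral>\<^sup>+\<omega>. indicator A (comp_H (\<lambda>j. W j \<omega>) n x) \<partial>M \<partial>\<nu> n)"
      by (subst nn_integral_fst[symmetric]) (auto simp: X_def)
    also have "\<dots> = (\<integral>\<^sup>+x. \<integral>\<^sup>+w. indicator A (comp_H w n x) \<partial>PiM {1..n} K \<partial>\<nu> n)"
    proof (rule nn_integral_cong)
      fix x
      have *: "(\<lambda>w. comp_H w n x) \<in> borel_measurable (\<Pi>\<^sub>M i\<in>{1..n}. borel)"
        by (intro borel_measurable_comp_H[of n "\<lambda>j w. w j"]) auto
      have "(\<integral>\<^sup>+w. indicator A (comp_H w n x) \<partial>PiM {1..n} K)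
          = (\<integral>\<^sup>+\<omega>. indicator A (comp_H (\<lambda>i\<in>{1..n}. W i \<omega>) n x) \<partial>M)"
        unfolding law[symmetric] using *
        by (intro nn_integral_distr measurable_restrict W) auto
      also have "\<dots> = (\<integral>\<^sup>+\<omega>. indicator A (comp_H (\<lambda>j. W j \<omega>) n x) \<partial>M)"
      proof -
        have "comp_H (\<lambda>i\<in>{1..n}. W i \<omega>) n = comp_H (\<lambda>i. W i \<omega>) n" for \<omega>
          by (rule comp_H_cong) auto
        then show ?thesis by simp
      qed
      finally show "(\<integral>\<^sup>+\<omega>. indicator A (comp_H (\<lambda>j. W j \<omega>) n x) \<partial>M)
          = (\<integral>\<^sup>+w. indicator A (comp_H w n x) \<partial>PiM {1..n} K)" ..
    qed
    also have "\<dots> = (\<integral>\<^sup>+x. indicator A x \<partial>\<nu> 0)"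
      by (rule nn_integral_comp_H_PiM) (use K \<nu> step in \<open>auto simp: K_def\<close>)
    also have "\<dots> = emeasure (\<nu> 0) A"
      using A \<nu>(2) by simp
    finally show "emeasure (distr (\<nu> n \<Otimes>\<^sub>M M) borel (X n)) A = emeasure (\<nu> 0) A" .
  qed (simp add: \<nu>(2))
  \<comment> \<open>The bound does not depend on the starting point \<open>x\<close>, so it survives
    integration over \<open>\<nu> n\<close>.\<close>
  have dist: "AE \<omega> in M. \<bar>comp_H (\<lambda>j. W j \<omega>) n x - Z \<omega>\<bar> \<le> e n \<omega>" if "0 \<le> x" "x \<le> 1" for n x
    using pos width by eventually_elim (use comp_H_converges(2) that in \<open>auto simp: Z_def e_def\<close>)
  have char_diff: "norm (char (\<nu> 0) t - char (distr M borel Z) t) \<le> \<bar>t\<bar> * (\<integral>\<omega>. e n \<omega> \<partial>M)"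
    if n: "n \<ge> 1" for t n
  proof -
    define h where "h x = (\<integral>\<omega>. iexp (t * X n (x, \<omega>)) - iexp (t * Z \<omega>) \<partial>M)" for x
    have int1: "integrable (\<nu> n \<Otimes>\<^sub>M M) (\<lambda>z. iexp (t * X n z))"
      by (rule P.integrable_const_bound[where B = 1]) (auto simp del: of_real_mult)
    have int2: "integrable (\<nu> n \<Otimes>\<^sub>M M) (\<lambda>z. iexp (t * Z (snd z)))"
      by (rule P.integrable_const_bound[where B = 1]) (auto simp del: of_real_mult)
    have "char (\<nu> 0) t = (\<integral>z. iexp (t * X n z) \<partial>(\<nu> n \<Otimes>\<^sub>M M))"
      unfolding char_def distr_X[OF n, symmetric] by (subst integral_distr) auto
    moreover have "char (distr M borel Z) t = (\<integral>z. iexp (t * Z (snd z)) \<partial>(\<nu> n \<Otimes>\<^sub>M M))"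
    proof -
      have "(\<integral>z. iexp (t * Z (snd z)) \<partial>(\<nu> n \<Otimes>\<^sub>M M)) = (\<integral>x. \<integral>\<omega>. iexp (t * Z \<omega>) \<partial>M \<partial>\<nu> n)"
        using P.integral_fst'[OF int2] by simp
      then show ?thesis
        unfolding char_def by (subst integral_distr) (auto simp: \<nu>.prob_space)
    qed
    ultimately have "char (\<nu> 0) t - char (distr M borel Z) t
        = (\<integral>z. iexp (t * X n z) - iexp (t * Z (snd z)) \<partial>(\<nu> n \<Otimes>\<^sub>M M))"
      using int1 int2 by simp
    also have "\<dots> = (\<integral>x. h x \<partial>\<nu> n)"
      using P.integral_fst'[OF Bochner_Integration.integrable_diff[OF int1 int2]] by (simp add: h_def)
    finally have eq: "char (\<nu> 0) t - char (distr M borel Z) t = (\<integral>x. h x \<partial>\<nu> n)" .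
    have h_bound: "AE x in \<nu> n. norm (h x) \<le> \<bar>t\<bar> * (\<integral>\<omega>. e n \<omega> \<partial>M)"
      using \<nu>(3)[of n]
    proof eventually_elim
      case (elim x)
      have Xx: "X n (x, \<omega>) = comp_H (\<lambda>j. W j \<omega>) n x" for \<omega>
        by (simp add: X_def)
      have "norm (h x) \<le> (\<integral>\<omega>. norm (iexp (t * X n (x, \<omega>)) - iexp (t * Z \<omega>)) \<partial>M)"
        unfolding h_def by (rule integral_norm_bound)
      also have "\<dots> \<le> (\<integral>\<omega>. \<bar>t\<bar> * e n \<omega> \<partial>M)"
      proof (rule integral_mono_AE)
        show "integrable M (\<lambda>\<omega>. norm (iexp (t * X n (x, \<omega>)) - iexp (t * Z \<omega>)))"
          unfolding Xx
          by (intro integrable_norm Bochner_Integration.integrable_diff integrable_const_bound[where B = 1])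
            (auto simp del: of_real_mult)
        show "AE \<omega> in M. norm (iexp (t * X n (x, \<omega>)) - iexp (t * Z \<omega>)) \<le> \<bar>t\<bar> * e n \<omega>"
          using dist[OF elim[THEN conjunct1] elim[THEN conjunct2], of n]
        proof eventually_elim
          case (elim \<omega>)
          have "norm (iexp (t * X n (x, \<omega>)) - iexp (t * Z \<omega>)) \<le> \<bar>t * X n (x, \<omega>) - t * Z \<omega>\<bar>"
            by (rule norm_iexp_diff_le)
          also have "\<dots> = \<bar>t\<bar> * \<bar>X n (x, \<omega>) - Z \<omega>\<bar>"
            by (simp add: abs_mult flip: right_diff_distrib)
          also have "\<dots> \<le> \<bar>t\<bar> * e n \<omega>"
            using elim by (intro mult_left_mono) (auto simp: Xx)
          finally show ?case .
        qed
      qed (simp add: e_int)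
      finally show ?case by simp
    qed
    have h_meas [measurable]: "h \<in> borel_measurable (\<nu> n)"
      unfolding h_def by measurable
    have "norm (\<integral>x. h x \<partial>\<nu> n) \<le> (\<integral>x. norm (h x) \<partial>\<nu> n)"
      by (rule integral_norm_bound)
    also have "\<dots> \<le> (\<integral>x. \<bar>t\<bar> * (\<integral>\<omega>. e n \<omega> \<partial>M) \<partial>\<nu> n)"
      using h_bound by (intro integral_mono_AE integrable_norm \<nu>.integrable_const_bound[OF h_bound]) auto
    finally show ?thesis
      by (simp add: eq \<nu>.prob_space)
  qed
  show "distr M borel Z = \<nu> 0"
  proof (rule Levy_uniqueness)
    show "real_distribution (distr M borel Z)" by simp
    show "real_distribution (\<nu> 0)"
      using \<nu> by (simp add: real_distribution_def real_distribution_axioms_def)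
    show "char (distr M borel Z) = char (\<nu> 0)"
    proof
      fix t
      have "norm (char (\<nu> 0) t - char (distr M borel Z) t) \<le> 0"
        by (rule LIMSEQ_le_const[OF e_lim]) (use char_diff in blast)
      then show "char (distr M borel Z) t = char (\<nu> 0) t" by simp
    qed
  qed
qed

theorem theorem4p2:
  fixes \<theta> :: real5 and v :: "nat \<Rightarrow> vertex"
    and M :: "'a measure" and W :: "nat \<Rightarrow> 'a \<Rightarrow> real"
  assumes path: "\<And>n. n \<ge> 1 \<Longrightarrow> (v n, v (n - 1)) \<in> parcs (G_star_star \<theta>)"
    and M: "prob_space M"
    and indep: "prob_space.indep_vars M (\<lambda>_. borel) W {1..}"
    and law: "\<And>n. n \<ge> 1 \<Longrightarrow> distr M borel (W n) = beta_edge (v n) (v (n - 1))"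
  shows "\<exists>Z \<in> borel_measurable M.
           (AE \<omega> in M. (\<forall>x>0. (\<lambda>n. comp_H (\<lambda>j. W j \<omega>) n x) \<longlonglongrightarrow> Z \<omega>)
              \<and> cfrac_convergent (\<lambda>j. W j \<omega>) \<longlonglongrightarrow> Z \<omega>)
           \<and> distr M borel Z = BH_vertex (v 0)"
proof -
  interpret prob_space M by (rule M)
  have W [measurable]: "W j \<in> borel_measurable M" if "j \<ge> 1" for j
    using indep that by (auto simp: indep_vars_def)
  \<comment> \<open>Every vertex of the path, \<open>v 0\<close> included, is the target of an
    edge.\<close>
  have exists: "BH_vertex_exists (v n)" for n
    using G_star_star_edge(2)[OF path[of "Suc n"]] by simp
  have "AE \<omega> in M. W j \<omega> > 0" if "j \<ge> 1" for j
  proof -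
    have "AE w in distr M borel (W j). w > 0"
      unfolding law[OF that] beta_edge_def by (rule AE_beta2)
    then show ?thesis
      using that by (subst (asm) AE_distr_iff) auto
  qed
  then have pos: "AE \<omega> in M. \<forall>j\<ge>1. W j \<omega> > 0"
    by (subst AE_all_countable, intro allI) (auto simp: AE_impI)
  obtain C where C: "C > 0" "\<And>n. n \<ge> 1 \<Longrightarrow> prob {\<omega> \<in> space M. W n \<omega> > C} \<le> 1 / 2"
  proof -
    let ?E = "parcs (G_star_star \<theta>)"
    let ?tail = "\<lambda>e D. measure (beta_edge (fst e) (snd e)) {w. w > D}"
    have "\<forall>e\<in>?E. \<exists>C. \<forall>D\<ge>C. ?tail e D \<le> 1 / 2"
    proof
      fix e assume "e \<in> ?E"
      then have "acceptable (fst e) (snd e)"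
        using G_star_star_edge(3)[of "fst e" "snd e"] by simp
      then obtain c d where cd: "c > 0" "d > 0" "beta_edge (fst e) (snd e) = beta2 c d"
        by (rule acceptable_rep)
      show "\<exists>C. \<forall>D\<ge>C. ?tail e D \<le> 1 / 2"
        unfolding cd(3) using prob_space.exists_tail_le_half[OF prob_space_beta2[OF cd(1,2)], of "\<lambda>x. x"] by simp
    qed
    from bchoice[OF this] obtain c where c: "\<And>e D. e \<in> ?E \<Longrightarrow> D \<ge> c e \<Longrightarrow> ?tail e D \<le> 1 / 2"
      by blast
    \<comment> \<open>One threshold for all edges. Including 1 makes the set nonempty and
      \<open>C\<close> positive.\<close>
    define C where "C = Max (insert 1 (c ` ?E))"
    have C: "1 \<le> C" "\<And>e. e \<in> ?E \<Longrightarrow> c e \<le> C"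
      unfolding C_def using finite_edges by (auto intro!: Max_ge)
    have "prob {\<omega> \<in> space M. W n \<omega> > C} \<le> 1 / 2" if n: "n \<ge> 1" for n
    proof -
      have "prob {\<omega> \<in> space M. W n \<omega> > C} = measure (distr M borel (W n)) {w. w > C}"
        using n by (subst measure_distr) (auto intro!: arg_cong[of _ _ prob])
      also have "\<dots> \<le> 1 / 2"
        unfolding law[OF n] using c[OF path[OF n], of C] C(2)[OF path[OF n]] by simp
      finally show ?thesis .
    qed
    with C(1) show thesis
      by (intro that[of C]) auto
  qed
  have often: "AE \<omega> in M. \<forall>m. \<exists>j\<ge>m. W j \<omega> \<le> C"
    by (rule AE_infinitely_often_le[OF indep C(2)])
  have width: "AE \<omega> in M. comp_H_width (\<lambda>j. W j \<omega>) \<longlonglongrightarrow> 0"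
    using pos often
    by eventually_elim (rule comp_H_width_tendsto_0, auto simp: C(1))
  \<comment> \<open>The limit of the convergents; off the almost sure event, \<open>lim\<close>
    merely supplies some value.\<close>
  define Z where "Z \<omega> = lim (\<lambda>n. comp_H (\<lambda>j. W j \<omega>) n 1)" for \<omega>
  have step: "distr (BH_vertex (v (Suc n)) \<Otimes>\<^sub>M distr M borel (W (Suc n))) borel (\<lambda>(x, w). H w x)
      = BH_vertex (v n)" for n
    using distr_BH_vertex_beta_edge_H[OF _ exists exists] G_star_star_edge(3)[OF path[of "Suc n"]] law[of "Suc n"]
    by simp
  have conc: "AE x in BH_vertex (v n). 0 \<le> x \<and> x \<le> 1" for n
    using AE_BH_vertex[of "v n"] by eventually_elim auto
  note limit = distr_backward_limit[OF indep prob_space_BH_vertex[OF exists] sets_BH_vertex conc step pos width,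
      folded Z_def]
  have "AE \<omega> in M. \<forall>x>0. (\<lambda>n. comp_H (\<lambda>j. W j \<omega>) n x) \<longlonglongrightarrow> Z \<omega>"
    using pos width by eventually_elim (use comp_H_converges(1) in \<open>auto simp: Z_def\<close>)
  then have "AE \<omega> in M. (\<forall>x>0. (\<lambda>n. comp_H (\<lambda>j. W j \<omega>) n x) \<longlonglongrightarrow> Z \<omega>)
      \<and> cfrac_convergent (\<lambda>j. W j \<omega>) \<longlonglongrightarrow> Z \<omega>"
    by eventually_elim (simp add: cfrac_convergent_eq[abs_def])
  then show ?thesis
    using limit by (intro bexI[of _ Z]) auto
qed

end
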